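(* Let $F$ be a global field, let $\mathbb{A}_F$ be its ring of adèles with the trivial involution, and let $n\ge1$. The ring of matrices $A=\mathrm{M}(n,\mathbb{A}_F)$, with the induced involution $a^*=a^t$ (matrix transpose), is $*$-Euclidean.
   Context: A global field is a number field or a function field in one variable over a finite field. For a ring with involution $(A,* )$ (an associative ring with identity and an anti-automorphism $*$ with $(a^* )^*=a$): $A^\times$ is the group of units and $A^{\mathrm{sym}}=\{a\in A: a^*=a\}$. $(A,* )$ is $*$-Euclidean if for all $a,c\in A$ with $Aa+Ac=A$ and $a^*c\in A^{\mathrm{sym}}$, setting $r_{-1}=a$, $r_0=c$, there exist an integer $m\ge1$ and elements $s_0,\dots,s_{m-1}\in A^{\mathrm{sym}}$, $r_1,\dots,r_{m-1}\in A$, $r_m\in A^\times$ such that $r_{i-1}=s_ir_i+r_{i+1}$ for $i=0,\dots,m-1$. *)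

theory Defs
  imports Complex_Main "Jordan_Normal_Form.Matrix" "HOL-Algebra.Algebra"
begin

section \<open>Global fields\<close>

text \<open>With no generators, \<^const>\<open>generate_field\<close> gives the prime field, which is a copy of the
  rationals in characteristic zero.\<close>

definition number_field :: "('a, 'm) ring_scheme \<Rightarrow> bool" where
  "number_field F \<longleftrightarrow> field F \<and>
     (\<forall>k::nat. k > 0 \<longrightarrow> add_pow F k \<one>\<^bsub>F\<^esub> \<noteq> \<zero>\<^bsub>F\<^esub>) \<and>
     ring.finite_dimension F (generate_field F {}) (carrier F)"

definition function_field_over_finite_field :: "('a, 'm) ring_scheme \<Rightarrow> bool" where
  "function_field_over_finite_field F \<longleftrightarrow> field F \<and>
     (\<exists>K t. subfield K F \<and> finite K \<and> t \<in> carrier F \<and> ring.transcendental F K t \<and>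
        ring.finite_dimension F (generate_field F (insert t K)) (carrier F))"

definition global_field :: "('a, 'm) ring_scheme \<Rightarrow> bool" where
  "global_field F \<longleftrightarrow> number_field F \<or> function_field_over_finite_field F"


section \<open>Places\<close>

definition absolute_value :: "('a, 'm) ring_scheme \<Rightarrow> ('a \<Rightarrow> real) \<Rightarrow> bool" where
  "absolute_value F f \<longleftrightarrow>
     (\<forall>x\<in>carrier F. f x \<ge> 0 \<and> (f x = 0 \<longleftrightarrow> x = \<zero>\<^bsub>F\<^esub>)) \<and>
     (\<forall>x\<in>carrier F. \<forall>y\<in>carrier F. f (x \<otimes>\<^bsub>F\<^esub> y) = f x * f y) \<and>
     (\<forall>x\<in>carrier F. \<forall>y\<in>carrier F. f (x \<oplus>\<^bsub>F\<^esub> y) \<le> f x + f y)"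

definition nontrivial_absolute_values :: "('a, 'm) ring_scheme \<Rightarrow> ('a \<Rightarrow> real) set" where
  "nontrivial_absolute_values F =
     {f. absolute_value F f \<and> (\<exists>x\<in>carrier F - {\<zero>\<^bsub>F\<^esub>}. f x \<noteq> 1)}"

text \<open>Values outside the carrier are irrelevant: the equivalence identifies absolute values that
  agree on the carrier.\<close>

definition absolute_value_equiv ::
    "('a, 'm) ring_scheme \<Rightarrow> (('a \<Rightarrow> real) \<times> ('a \<Rightarrow> real)) set" where
  "absolute_value_equiv F =
     {(f, g). f \<in> nontrivial_absolute_values F \<and> g \<in> nontrivial_absolute_values F \<and>
        (\<exists>e>0. \<forall>x\<in>carrier F. g x = f x powr e)}"

definition places :: "('a, 'm) ring_scheme \<Rightarrow> ('a \<Rightarrow> real) set set" where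
  "places F = nontrivial_absolute_values F // absolute_value_equiv F"

definition nonarchimedean :: "('a, 'm) ring_scheme \<Rightarrow> ('a \<Rightarrow> real) \<Rightarrow> bool" where
  "nonarchimedean F f \<longleftrightarrow>
     (\<forall>x\<in>carrier F. \<forall>y\<in>carrier F. f (x \<oplus>\<^bsub>F\<^esub> y) \<le> max (f x) (f y))"


section \<open>Completions\<close>

definition cauchy_seqs :: "('a, 'm) ring_scheme \<Rightarrow> ('a \<Rightarrow> real) \<Rightarrow> (nat \<Rightarrow> 'a) set" where
  "cauchy_seqs F f = {\<xi>. (\<forall>i. \<xi> i \<in> carrier F) \<and>
     (\<forall>e>0. \<exists>N. \<forall>i\<ge>N. \<forall>j\<ge>N. f (\<xi> i \<ominus>\<^bsub>F\<^esub> \<xi> j) < e)}"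

definition null_seqs :: "('a, 'm) ring_scheme \<Rightarrow> ('a \<Rightarrow> real) \<Rightarrow> (nat \<Rightarrow> 'a) set" where
  "null_seqs F f = {\<xi>. (\<forall>i. \<xi> i \<in> carrier F) \<and> (\<lambda>i. f (\<xi> i)) \<longlonglongrightarrow> 0}"

definition cauchy_ring :: "('a, 'm) ring_scheme \<Rightarrow> ('a \<Rightarrow> real) \<Rightarrow> (nat \<Rightarrow> 'a) ring" where
  "cauchy_ring F f =
     \<lparr>carrier = cauchy_seqs F f,
      monoid.mult = (\<lambda>\<xi> \<eta> i. \<xi> i \<otimes>\<^bsub>F\<^esub> \<eta> i),
      one = (\<lambda>i. \<one>\<^bsub>F\<^esub>),
      ring.zero = (\<lambda>i. \<zero>\<^bsub>F\<^esub>),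
      add = (\<lambda>\<xi> \<eta> i. \<xi> i \<oplus>\<^bsub>F\<^esub> \<eta> i)\<rparr>"

definition completion :: "('a, 'm) ring_scheme \<Rightarrow> ('a \<Rightarrow> real) \<Rightarrow> (nat \<Rightarrow> 'a) set ring" where
  "completion F f = cauchy_ring F f Quot null_seqs F f"

text \<open>An element of the completion is a class of Cauchy sequences, and its absolute value is the
  common limit of \<open>f (\<xi> i)\<close> over the sequences \<open>\<xi>\<close> in the class.  For nonarchimedean \<open>f\<close> the
  following set is the valuation ring of the completion.\<close>

definition completion_integers ::
    "('a, 'm) ring_scheme \<Rightarrow> ('a \<Rightarrow> real) \<Rightarrow> (nat \<Rightarrow> 'a) set set" where
  "completion_integers F f =
     {x \<in> carrier (completion F f). \<forall>\<xi>\<in>x. lim (\<lambda>i. f (\<xi> i)) \<le> 1}"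


section \<open>Adeles\<close>

text \<open>Equivalent absolute values have the same Cauchy sequences, the same null sequences and the
  same integers, so nothing below depends on the representative chosen at a place.\<close>

definition place_abs :: "('a \<Rightarrow> real) set \<Rightarrow> 'a \<Rightarrow> real" where
  "place_abs v = (SOME f. f \<in> v)"

text \<open>The integrality condition concerns the nonarchimedean places only; a global field has
  finitely many archimedean ones.\<close>

definition adele_ring ::
    "('a, 'm) ring_scheme \<Rightarrow> (('a \<Rightarrow> real) set \<Rightarrow> (nat \<Rightarrow> 'a) set) ring" where
  "adele_ring F =
     \<lparr>carrier = {x \<in> (\<Pi>\<^sub>E v\<in>places F. carrier (completion F (place_abs v))).
        finite {v \<in> places F. nonarchimedean F (place_abs v) \<and>
                              x v \<notin> completion_integers F (place_abs v)}},
      monoid.mult = (\<lambda>x y. \<lambda>v\<in>places F. x v \<otimes>\<^bsub>completion F (place_abs v)\<^esub> y v),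
      one = (\<lambda>v\<in>places F. \<one>\<^bsub>completion F (place_abs v)\<^esub>),
      ring.zero = (\<lambda>v\<in>places F. \<zero>\<^bsub>completion F (place_abs v)\<^esub>),
      add = (\<lambda>x y. \<lambda>v\<in>places F. x v \<oplus>\<^bsub>completion F (place_abs v)\<^esub> y v)\<rparr>"


section \<open>Matrix rings\<close>

text \<open>\<^const>\<open>ring_mat\<close> takes its entries in a type of class \<^class>\<open>semiring_1\<close>; here they lie in
  the carrier of a ring record.\<close>

definition matrix_ring :: "nat \<Rightarrow> ('a, 'm) ring_scheme \<Rightarrow> 'a mat ring" where
  "matrix_ring n R =
     \<lparr>carrier = {M \<in> carrier_mat n n. elements_mat M \<subseteq> carrier R},
      monoid.mult = (\<lambda>M N. mat n n (\<lambda>(i, j). \<Oplus>\<^bsub>R\<^esub>k\<in>{..<n}. M $$ (i, k) \<otimes>\<^bsub>R\<^esub> N $$ (k, j))),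
      one = mat n n (\<lambda>(i, j). if i = j then \<one>\<^bsub>R\<^esub> else \<zero>\<^bsub>R\<^esub>),
      ring.zero = mat n n (\<lambda>(i, j). \<zero>\<^bsub>R\<^esub>),
      add = (\<lambda>M N. mat n n (\<lambda>(i, j). M $$ (i, j) \<oplus>\<^bsub>R\<^esub> N $$ (i, j)))\<rparr>"


section \<open>Rings with involution and the Euclidean property\<close>

locale ring_with_involution = ring A for A (structure) +
  fixes star :: "'a \<Rightarrow> 'a"
  assumes star_closed: "x \<in> carrier A \<Longrightarrow> star x \<in> carrier A"
    and star_add: "\<lbrakk>x \<in> carrier A; y \<in> carrier A\<rbrakk> \<Longrightarrow> star (x \<oplus> y) = star x \<oplus> star y"
    and star_mult: "\<lbrakk>x \<in> carrier A; y \<in> carrier A\<rbrakk> \<Longrightarrow> star (x \<otimes> y) = star y \<otimes> star x"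
    and star_star: "x \<in> carrier A \<Longrightarrow> star (star x) = x"

definition sym_elements :: "('a, 'm) ring_scheme \<Rightarrow> ('a \<Rightarrow> 'a) \<Rightarrow> 'a set" where
  "sym_elements A star = {x \<in> carrier A. star x = x}"

text \<open>The remainders are indexed with a shift: \<open>r (i + 1)\<close> stands for the \<open>i\<close>-th remainder, so
  that the sequence starting at index \<open>-1\<close> becomes one on the natural numbers.\<close>

definition star_euclidean :: "('a, 'm) ring_scheme \<Rightarrow> ('a \<Rightarrow> 'a) \<Rightarrow> bool" where
  "star_euclidean A star \<longleftrightarrow> ring_with_involution A star \<and>
     (\<forall>a\<in>carrier A. \<forall>c\<in>carrier A.
        (carrier A #>\<^bsub>A\<^esub> a) <+>\<^bsub>A\<^esub> (carrier A #>\<^bsub>A\<^esub> c) = carrier A \<longrightarrow>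
        star a \<otimes>\<^bsub>A\<^esub> c \<in> sym_elements A star \<longrightarrow>
        (\<exists>m\<ge>1. \<exists>s r :: nat \<Rightarrow> 'a.
           r 0 = a \<and> r 1 = c \<and>
           (\<forall>i<m. s i \<in> sym_elements A star) \<and>
           (\<forall>i\<le>m. r i \<in> carrier A) \<and>
           r (m + 1) \<in> Units A \<and>
           (\<forall>i<m. r i = s i \<otimes>\<^bsub>A\<^esub> r (i + 1) \<oplus>\<^bsub>A\<^esub> r (i + 2))))"

end

theory Submission
  imports Defs
begin

text \<open>
  A single division step suffices: if \<open>a\<^sup>t c\<close> is symmetric and \<open>A a + A c = A\<close>, then there is a symmetric
  \<open>s\<close> with \<open>a + s c\<close> invertible, and \<open>a = (- s) c + (a + s c)\<close> is a Euclidean chain that ends in a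
  unit.  A fixed number of steps is suited to the adeles, where it must not depend on
  the place while the matrices must stay integral at almost all places.

  The pairs \<open>(a, c)\<close> in question are Lagrangians: \<open>a\<close> and \<open>c\<close>, stacked, form a \<open>2n\<close> by \<open>n\<close> matrix
  whose columns span an isotropic direct summand of the symplectic module of rank \<open>2n\<close>.  The
  question is whether the shears \<open>a \<mapsto> a + s c\<close> move it to one whose upper block is invertible.  The
  symplectic group also contains \<open>(a, c) \<mapsto> (g a, g\<^sup>-\<^sup>t c)\<close>, and bases of the Lagrangian can be changed by
  right multiplication with an invertible \<open>h\<close>.  Solvability is invariant under all three moves
  (lemmas \<open>shiftable_shear\<close> and \<open>shiftable_conj\<close>), so these can be used to bring \<open>a\<close> to the identity
  one row at a time (\<open>shiftable_step\<close>).  Treating row \<open>k\<close> amounts to making one diagonal entry of \<open>a\<close>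
  invertible.  The \<open>k\<close>-th column of the pair generates the unit ideal, and symmetry of \<open>a\<^sup>t c\<close> puts
  those of its entries which lie in the rows already treated into the span of the others.  So what is
  needed is that in the ring of coefficients \<open>x a + y b = 1\<close> implies that some \<open>a + t b\<close> is a unit.
  This is Bass's condition of stable range one.

  The elimination is carried out in an abstract ring with involution, where the coefficient ring
  appears as the corner \<open>E A E\<close> of a symmetric idempotent \<open>E\<close> (the \<open>k\<close>-th diagonal matrix unit); this
  turns all matrix computations into identities between a few ring elements
  (\<open>shiftable_of_chain\<close>, specialised to matrices in \<open>star_euclidean_matrix_ring\<close>).

  The ring of adeles has stable range one because one can take \<open>t\<close> equal to \<open>0\<close> or \<open>1\<close> at every place
  (\<open>shift_to_unit\<close>).  In a completion, which is a field, take \<open>t = 0\<close> unless \<open>a = 0\<close>.  At the almost all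
  nonarchimedean places where \<open>x, a, y, b\<close> are integral one works instead in the valuation ring, which
  is local: if \<open>a\<close> is not a unit there, then \<open>b\<close> and hence \<open>a + b\<close> is.  The inverse of \<open>a + t b\<close> is
  therefore integral at almost all places, and so it is an adele (\<open>adele_ring_stable_range_one\<close>).
\<close>

section \<open>Lagrangian pairs in a ring with involution\<close>

text \<open>The simplification set \<open>ring_simprules\<close> sorts sums and so can leave \<open>x\<close> and \<open>- x\<close> separated by a
  third summand.\<close>

lemma (in ring) add_cancel:
  assumes "x \<in> carrier R" "y \<in> carrier R"
  shows "x \<oplus> (y \<oplus> \<ominus> x) = y"
  using assms by (simp add: a_lcomm[of x] r_neg)

context ring_with_involution
begin

lemma star_one [simp]: "star \<one> = \<one>"
proof -
  have "star \<one> = star \<one> \<otimes> star (star \<one>)"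
    by (simp add: star_closed star_star)
  also have "\<dots> = star (star \<one> \<otimes> \<one>)"
    by (subst star_mult) (simp_all add: star_closed)
  finally show ?thesis by (simp add: star_closed star_star)
qed

lemma star_zero [simp]: "star \<zero> = \<zero>"
  using star_add[of \<zero> \<zero>] by (simp add: star_closed)

lemma star_minus: "x \<in> carrier A \<Longrightarrow> star (\<ominus> x) = \<ominus> star x"
  using star_add[of "\<ominus> x" x] by (simp add: star_closed l_neg minus_equality)

lemmas star_simps = star_closed star_add star_mult star_star star_minus

text \<open>The graph-like submodule \<open>{(a z, c z)}\<close> is isotropic for the form \<open>((u, v), (u', v')) \<mapsto> u\<^sup>* v' - v\<^sup>* u'\<close>
  by the equation, and a direct summand by the Bezout identity.\<close>
definition lagrangian :: "'a \<Rightarrow> 'a \<Rightarrow> bool" where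
  "lagrangian a c \<longleftrightarrow> a \<in> carrier A \<and> c \<in> carrier A \<and> star a \<otimes> c = star c \<otimes> a \<and>
     (\<exists>x\<in>carrier A. \<exists>y\<in>carrier A. x \<otimes> a \<oplus> y \<otimes> c = \<one>)"

definition shiftable :: "'a \<Rightarrow> 'a \<Rightarrow> bool" where
  "shiftable a c \<longleftrightarrow> (\<exists>s\<in>sym_elements A star. a \<oplus> s \<otimes> c \<in> Units A)"

lemma lagrangian_shear:
  assumes "lagrangian a c" "s \<in> sym_elements A star"
  shows "lagrangian (a \<oplus> s \<otimes> c) c"
proof -
  from assms obtain x y where C [simp]: "a \<in> carrier A" "c \<in> carrier A" "s \<in> carrier A"
      "x \<in> carrier A" "y \<in> carrier A"
    and ac: "star a \<otimes> c = star c \<otimes> a" and ss: "star s = s" and xy: "x \<otimes> a \<oplus> y \<otimes> c = \<one>"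
    unfolding lagrangian_def sym_elements_def by auto
  have 1: "star (a \<oplus> s \<otimes> c) \<otimes> c = star c \<otimes> (a \<oplus> s \<otimes> c)"
    by (simp add: star_simps ring_simprules ac ss)
  have "x \<otimes> (a \<oplus> s \<otimes> c) \<oplus> (y \<oplus> \<ominus> (x \<otimes> s)) \<otimes> c = x \<otimes> a \<oplus> y \<otimes> c"
    by (simp add: ring_simprules)
  with xy have "\<exists>x\<in>carrier A. \<exists>y\<in>carrier A. x \<otimes> (a \<oplus> s \<otimes> c) \<oplus> y \<otimes> c = \<one>"
    by (intro bexI[of _ x] bexI[of _ "y \<oplus> \<ominus> (x \<otimes> s)"]) auto
  with 1 show ?thesis unfolding lagrangian_def by simp
qed

lemma shiftable_shear:
  assumes "shiftable (a \<oplus> s \<otimes> c) c" "s \<in> sym_elements A star"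
    and [simp]: "a \<in> carrier A" "c \<in> carrier A"
  shows "shiftable a c"
proof -
  from assms obtain s' where s': "s' \<in> sym_elements A star" "a \<oplus> s \<otimes> c \<oplus> s' \<otimes> c \<in> Units A"
    unfolding shiftable_def by auto
  have [simp]: "s \<in> carrier A" "s' \<in> carrier A" and "star s = s" "star s' = s'"
    using assms(2) s'(1) by (auto simp: sym_elements_def)
  then have "s \<oplus> s' \<in> sym_elements A star"
    by (simp add: sym_elements_def star_add)
  moreover have "a \<oplus> (s \<oplus> s') \<otimes> c = a \<oplus> s \<otimes> c \<oplus> s' \<otimes> c"
    by (simp add: ring_simprules)
  ultimately show ?thesis using s'(2) unfolding shiftable_def by metis
qed

text \<open>The matrix \<open>diag(g, (g\<^sup>*)\<^sup>-\<^sup>1)\<close> is symplectic, and \<open>h\<close> only changes the basis of the Lagrangian.\<close>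
lemma lagrangian_conj:
  assumes "lagrangian a c" and C [simp]: "g \<in> carrier A" "g' \<in> carrier A" "h \<in> carrier A" "h' \<in> carrier A"
    and gg: "g \<otimes> g' = \<one>" "g' \<otimes> g = \<one>" and hh: "h \<otimes> h' = \<one>" "h' \<otimes> h = \<one>"
  shows "lagrangian (g \<otimes> a \<otimes> h) (star g' \<otimes> c \<otimes> h)"
proof -
  from assms obtain x y where C' [simp]: "a \<in> carrier A" "c \<in> carrier A"
      "x \<in> carrier A" "y \<in> carrier A"
    and ac: "star a \<otimes> c = star c \<otimes> a" and xy: "x \<otimes> a \<oplus> y \<otimes> c = \<one>"
    unfolding lagrangian_def by auto
  have sgg: "star g \<otimes> star g' = \<one>"
    using star_mult[of g' g] gg star_one by simp
  have "star (g \<otimes> a \<otimes> h) \<otimes> (star g' \<otimes> c \<otimes> h)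
      = star h \<otimes> star a \<otimes> (star g \<otimes> star g') \<otimes> c \<otimes> h"
    by (simp add: star_simps m_assoc)
  also have "\<dots> = star h \<otimes> (star a \<otimes> c) \<otimes> h"
    by (simp add: sgg star_closed m_assoc)
  also have "\<dots> = star h \<otimes> star c \<otimes> (g' \<otimes> g) \<otimes> a \<otimes> h"
    by (simp add: ac gg star_closed m_assoc)
  also have "\<dots> = star (star g' \<otimes> c \<otimes> h) \<otimes> (g \<otimes> a \<otimes> h)"
    by (simp add: star_simps m_assoc)
  finally have 1: "star (g \<otimes> a \<otimes> h) \<otimes> (star g' \<otimes> c \<otimes> h)
      = star (star g' \<otimes> c \<otimes> h) \<otimes> (g \<otimes> a \<otimes> h)" .
  have "(h' \<otimes> x \<otimes> g') \<otimes> (g \<otimes> a \<otimes> h) \<oplus> (h' \<otimes> y \<otimes> star g) \<otimes> (star g' \<otimes> c \<otimes> h)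
      = h' \<otimes> x \<otimes> (g' \<otimes> g) \<otimes> a \<otimes> h \<oplus> h' \<otimes> y \<otimes> (star g \<otimes> star g') \<otimes> c \<otimes> h"
    by (simp add: star_closed m_assoc )
  also have "\<dots> = h' \<otimes> (x \<otimes> a \<oplus> y \<otimes> c) \<otimes> h"
    by (simp add: gg sgg ring_simprules)
  also have "\<dots> = \<one>" by (simp add: xy hh)
  finally have "(h' \<otimes> x \<otimes> g') \<otimes> (g \<otimes> a \<otimes> h) \<oplus> (h' \<otimes> y \<otimes> star g) \<otimes> (star g' \<otimes> c \<otimes> h) = \<one>" .
  then have "\<exists>x\<in>carrier A. \<exists>y\<in>carrier A. x \<otimes> (g \<otimes> a \<otimes> h) \<oplus> y \<otimes> (star g' \<otimes> c \<otimes> h) = \<one>"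
    by (intro bexI[of _ "h' \<otimes> x \<otimes> g'"] bexI[of _ "h' \<otimes> y \<otimes> star g"]) (auto simp: star_closed)
  with 1 show ?thesis unfolding lagrangian_def by (simp add: star_closed)
qed

text \<open>Conjugation by \<open>diag(g, (g\<^sup>*)\<^sup>-\<^sup>1)\<close> carries the shear by \<open>g\<^sup>-\<^sup>1 s (g\<^sup>-\<^sup>1)\<^sup>*\<close> to the shear by \<open>s\<close>.\<close>
lemma shiftable_conj:
  assumes "shiftable (g \<otimes> a \<otimes> h) (star g' \<otimes> c \<otimes> h)"
    and C [simp]: "a \<in> carrier A" "c \<in> carrier A"
      "g \<in> carrier A" "g' \<in> carrier A" "h \<in> carrier A" "h' \<in> carrier A"
    and gg: "g \<otimes> g' = \<one>" "g' \<otimes> g = \<one>" and hh: "h \<otimes> h' = \<one>" "h' \<otimes> h = \<one>"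
  shows "shiftable a c"
proof -
  obtain s where [simp]: "s \<in> carrier A" "star s = s"
    and u: "g \<otimes> a \<otimes> h \<oplus> s \<otimes> (star g' \<otimes> c \<otimes> h) \<in> Units A"
    using assms(1) by (auto simp: shiftable_def sym_elements_def)
  have U: "g' \<in> Units A" "h' \<in> Units A"
    using gg hh by (auto simp: Units_def)
  define s' where "s' = g' \<otimes> s \<otimes> star g'"
  have s': "s' \<in> sym_elements A star"
    by (simp add: sym_elements_def s'_def star_simps m_assoc)
  have "g' \<otimes> (g \<otimes> a \<otimes> h \<oplus> s \<otimes> (star g' \<otimes> c \<otimes> h)) \<otimes> h'
      = (g' \<otimes> g) \<otimes> a \<otimes> (h \<otimes> h') \<oplus> s' \<otimes> c \<otimes> (h \<otimes> h')"
    by (simp add: s'_def star_closed m_assoc l_distr r_distr )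
  also have "\<dots> = a \<oplus> s' \<otimes> c"
    using s' by (simp add: gg hh sym_elements_def)
  finally have "a \<oplus> s' \<otimes> c \<in> Units A"
    using U u by (metis Units_m_closed)
  with s' show ?thesis unfolding shiftable_def by blast
qed


definition corner :: "'a \<Rightarrow> 'a set" where
  "corner e = {x \<in> carrier A. e \<otimes> x = x \<and> x \<otimes> e = x}"

section \<open>Elimination along a chain of symmetric idempotents\<close>

text \<open>
  One step of the elimination.  In the matrix picture \<open>p\<close> is the projection to the first \<open>k\<close>
  coordinates and \<open>E\<close> the projection to the next one.  The hypothesis \<open>p a = p\<close> says that the first \<open>k\<close>
  rows of \<open>a\<close> are those of the identity, and the moves of the proof achieve this for one more row.
  The condition \<open>sym\<close> makes the corner commutative, since the involution reverses products.
\<close>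
lemma shiftable_step:
  assumes C [simp]: "p \<in> carrier A" "E \<in> carrier A"
    and pp [simp]: "p \<otimes> p = p" "star p = p" and EE [simp]: "E \<otimes> E = E" "star E = E"
    and pE [simp]: "p \<otimes> E = \<zero>" "E \<otimes> p = \<zero>"
    and sym: "\<And>x. x \<in> corner E \<Longrightarrow> star x = x"
    and sr: "\<And>x a b. \<lbrakk>x \<in> corner E; a \<in> corner E; b \<in> corner E; x \<otimes> a \<oplus> b = E\<rbrakk>
      \<Longrightarrow> \<exists>t\<in>corner E. \<exists>u\<in>corner E. (a \<oplus> t \<otimes> b) \<otimes> u = E"
    and IH: "\<And>a c. \<lbrakk>lagrangian a c; (p \<oplus> E) \<otimes> a = p \<oplus> E\<rbrakk> \<Longrightarrow> shiftable a c"
    and lag: "lagrangian a c" and pa [simp]: "p \<otimes> a = p"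
  shows "shiftable a c"
proof -
  have assoc: "x \<otimes> (y \<otimes> w) = z \<otimes> w"
    if "x \<otimes> y = z" "x \<in> carrier A" "y \<in> carrier A" "w \<in> carrier A" for x y z w
    using that m_assoc by metis
  from lag obtain x y where C' [simp]: "a \<in> carrier A" "c \<in> carrier A"
      "x \<in> carrier A" "y \<in> carrier A"
    and ac: "star a \<otimes> c = star c \<otimes> a" and xy: "x \<otimes> a \<oplus> y \<otimes> c = \<one>"
    unfolding lagrangian_def by auto
  note [simp] = star_closed star_star assoc[OF pp(1)] assoc[OF EE(1)] assoc[OF pE(1)] assoc[OF pE(2)] assoc[OF pa]
  have ap [simp]: "star a \<otimes> p = p" using star_mult[of p a] by simp
  define f where "f = \<one> \<ominus> p"
  have [simp]: "f \<in> carrier A" by (simp add: f_def)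
  have fp [simp]: "f \<otimes> p = \<zero>" and fE [simp]: "f \<otimes> E = E"
    by (simp_all add: f_def ring_simprules)
  have pf: "z = p \<otimes> z \<oplus> f \<otimes> z" if "z \<in> carrier A" for z
    using that by (simp add: f_def ring_simprules)
  \<comment> \<open>The Bezout relation for column \<open>E\<close>, rewritten so that its coefficients vanish on \<open>p\<close>.  The
    formulas for \<open>x'\<close> and \<open>y'\<close> come from substituting \<open>p c E = c\<^sup>* a E - a\<^sup>* f c E\<close>, which is the
    isotropy relation read in column \<open>E\<close>, into \<open>E (x a + y c) E = E\<close>.\<close>
  define x' where "x' = E \<otimes> (x \<oplus> y \<otimes> star c) \<otimes> f"
  define y' where "y' = E \<otimes> (y \<ominus> y \<otimes> star a) \<otimes> f"
  have [simp]: "x' \<in> carrier A" "y' \<in> carrier A" by (simp_all add: x'_def y'_def)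
  have EX [simp]: "E \<otimes> x' = x'" and EY [simp]: "E \<otimes> y' = y'"
    by (simp_all add: x'_def y'_def m_assoc)
  have Xp [simp]: "x' \<otimes> p = \<zero>" and Yp [simp]: "y' \<otimes> p = \<zero>"
    by (simp_all add: x'_def y'_def m_assoc)
  have faE: "f \<otimes> (a \<otimes> E) = a \<otimes> E"
    by (simp add: f_def ring_simprules)
  have pcE: "p \<otimes> (c \<otimes> E) = star c \<otimes> (a \<otimes> E) \<ominus> star a \<otimes> (f \<otimes> (c \<otimes> E))"
  proof -
    have "star c \<otimes> (a \<otimes> E) = star a \<otimes> (c \<otimes> E)"
      by (simp flip: m_assoc add: ac)
    also have "\<dots> = star a \<otimes> (p \<otimes> (c \<otimes> E) \<oplus> f \<otimes> (c \<otimes> E))"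
      using pf[of "c \<otimes> E"] by simp
    also have "\<dots> = p \<otimes> (c \<otimes> E) \<oplus> star a \<otimes> (f \<otimes> (c \<otimes> E))"
      by (simp add: r_distr assoc[OF ap])
    finally show ?thesis by (simp add: ring_simprules)
  qed
  have XY: "x' \<otimes> (a \<otimes> E) \<oplus> y' \<otimes> (c \<otimes> E) = E"
  proof -
    have "x' \<otimes> (a \<otimes> E) \<oplus> y' \<otimes> (c \<otimes> E)
        = E \<otimes> (x \<otimes> (a \<otimes> E) \<oplus> y \<otimes> (star c \<otimes> (a \<otimes> E) \<ominus> star a \<otimes> (f \<otimes> (c \<otimes> E)) \<oplus> f \<otimes> (c \<otimes> E)))"
      by (simp add: x'_def y'_def faE ring_simprules)
    also have "\<dots> = E \<otimes> (x \<otimes> (a \<otimes> E) \<oplus> y \<otimes> (c \<otimes> E))"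
      using pf[of "c \<otimes> E"] by (simp flip: pcE)
    also have "\<dots> = E \<otimes> (x \<otimes> a \<oplus> y \<otimes> c) \<otimes> E"
      by (simp add: ring_simprules)
    finally show ?thesis by (simp add: xy)
  qed
  define q where "q = \<one> \<ominus> E"
  have [simp]: "q \<in> carrier A" by (simp add: q_def)
  have qE [simp]: "q \<otimes> E = \<zero>" and Eq [simp]: "E \<otimes> q = \<zero>" and pq [simp]: "p \<otimes> q = p"
    and qp [simp]: "q \<otimes> p = p" and qq [simp]: "q \<otimes> q = q" and qE1: "q \<oplus> E = \<one>"
    by (simp_all add: q_def ring_simprules add_cancel)
  note [simp] = assoc[OF qE] assoc[OF Eq] assoc[OF pq] assoc[OF qp] assoc[OF qq]
    assoc[OF EX] assoc[OF EY] assoc[OF Xp] assoc[OF Yp]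
  have split: "z = q \<otimes> z \<oplus> E \<otimes> z" if "z \<in> carrier A" for z
    using that qE1 by (metis \<open>q \<in> carrier A\<close> C(2) l_distr l_one)
  \<comment> \<open>With \<open>E a E\<close> split off, the rest \<open>b\<close> of the relation is what may be added, with a factor \<open>t\<close>,
    to the diagonal entry.\<close>
  define b where "b = x' \<otimes> (q \<otimes> (a \<otimes> E)) \<oplus> y' \<otimes> (c \<otimes> E)"
  have b: "b \<in> corner E" by (simp add: corner_def b_def l_distr r_distr m_assoc)
  have "x' \<otimes> E \<otimes> (E \<otimes> a \<otimes> E) \<oplus> b = x' \<otimes> (q \<otimes> (a \<otimes> E) \<oplus> E \<otimes> (a \<otimes> E)) \<oplus> y' \<otimes> (c \<otimes> E)"
    by (simp add: b_def ring_simprules)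
  also have "\<dots> = E" using XY split[of "a \<otimes> E"] by simp
  finally have "x' \<otimes> E \<otimes> (E \<otimes> a \<otimes> E) \<oplus> b = E" .
  moreover have "x' \<otimes> E \<in> corner E" "E \<otimes> a \<otimes> E \<in> corner E"
    by (simp_all add: corner_def m_assoc)
  ultimately obtain t u' where t: "t \<in> corner E" and u': "u' \<in> corner E"
    and uu: "(E \<otimes> a \<otimes> E \<oplus> t \<otimes> b) \<otimes> u' = E"
    using sr b by blast
  define u where "u = E \<otimes> a \<otimes> E \<oplus> t \<otimes> b"
  have [simp]: "t \<in> carrier A" "b \<in> carrier A" "u' \<in> carrier A" "u \<in> carrier A"
    and Et [simp]: "E \<otimes> t = t" "t \<otimes> E = t" and Eb [simp]: "E \<otimes> b = b" "b \<otimes> E = b"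
    and Eu' [simp]: "E \<otimes> u' = u'" "u' \<otimes> E = u'"
    using t b u' by (auto simp: corner_def u_def)
  note [simp] = assoc[OF Et(1)] assoc[OF Et(2)] assoc[OF Eb(1)] assoc[OF Eb(2)]
    assoc[OF Eu'(1)] assoc[OF Eu'(2)]
  have u: "u \<in> corner E" by (simp add: corner_def u_def l_distr r_distr m_assoc)
  have uu' [simp]: "u \<otimes> u' = E" using uu by (simp add: u_def)
  have u'u [simp]: "u' \<otimes> u = E"
  proof -
    have "u' \<otimes> u = star u' \<otimes> star u" using sym u u' by simp
    also have "\<dots> = star (u \<otimes> u')" by (rule star_mult[symmetric]) simp_all
    finally show ?thesis by simp
  qed
  note [simp] = assoc[OF uu'] assoc[OF u'u]
  \<comment> \<open>Left multiplication by \<open>1 + N\<close> adds \<open>t x'_j\<close> times row \<open>j\<close> to row \<open>k\<close>, for every \<open>j \<noteq> k\<close>; its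
    \<open>k\<close>-th row is \<open>W\<close>.  The shear \<open>s\<close> has to contribute \<open>t y' c\<close> to the same row after this operation,
    so a symmetric solution of \<open>W s = V\<close> is needed, and the \<open>s\<close> below is one because
    \<open>W V = V\<close> and \<open>W W = W\<close>.\<close>
  define N where "N = t \<otimes> x' \<otimes> q"
  define W where "W = E \<oplus> N"
  define V where "V = t \<otimes> y'"
  have [simp]: "N \<in> carrier A" "W \<in> carrier A" "V \<in> carrier A"
    by (simp_all add: N_def W_def V_def)
  have pt: "p \<otimes> t = \<zero>"
    by (metis Et(1) C(1,2) \<open>t \<in> carrier A\<close> pE(1) assoc l_null)
  have pu': "p \<otimes> u' = \<zero>"
    by (metis Eu'(1) C(1,2) \<open>u' \<in> carrier A\<close> pE(1) assoc l_null)
  have qu': "q \<otimes> u' = \<zero>"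
    by (metis Eu'(1) C(2) \<open>u' \<in> carrier A\<close> \<open>q \<in> carrier A\<close> qE assoc l_null)
  note [simp] = pt assoc[OF pt] pu' assoc[OF pu'] qu' assoc[OF qu']
  have NE [simp]: "N \<otimes> E = \<zero>" "E \<otimes> N = N" "p \<otimes> N = \<zero>"
    and EV [simp]: "E \<otimes> V = V" "V \<otimes> p = \<zero>" "p \<otimes> V = \<zero>"
    by (simp_all add: N_def V_def m_assoc)
  note [simp] = assoc[OF NE(1)] assoc[OF NE(2)] assoc[OF NE(3)] assoc[OF EV(1)] assoc[OF EV(2)] assoc[OF EV(3)]
  have NN [simp]: "N \<otimes> N = \<zero>"
  proof -
    have "N \<otimes> N = N \<otimes> (E \<otimes> N)" by (simp only: NE)
    also have "\<dots> = \<zero>" by (simp del: NE(2))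
    finally show ?thesis .
  qed
  have NV [simp]: "N \<otimes> V = \<zero>"
  proof -
    have "N \<otimes> V = N \<otimes> (E \<otimes> V)" by (simp only: EV)
    also have "\<dots> = \<zero>" by (simp del: EV(1))
    finally show ?thesis .
  qed
  note [simp] = assoc[OF NN] assoc[OF NV]
  have VE [simp]: "star V \<otimes> E = star V" "p \<otimes> star V = \<zero>"
    using star_mult[of E V] star_mult[of V p] by simp_all
  define s where "s = V \<oplus> star V \<ominus> W \<otimes> star V"
  have WVsym: "star (W \<otimes> star V) = W \<otimes> star V"
    by (rule sym) (simp add: corner_def W_def l_distr r_distr m_assoc)
  have [simp]: "s \<in> carrier A" by (simp add: s_def)
  have s: "s \<in> sym_elements A star"
    by (simp add: sym_elements_def s_def minus_eq star_add star_minus WVsym a_comm)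
  have ps [simp]: "p \<otimes> s = \<zero>"
    by (simp add: s_def W_def ring_simprules)
  have Ws: "W \<otimes> s = V"
    by (simp add: s_def W_def ring_simprules)
  \<comment> \<open>After the shear and the row operation the diagonal entry is the unit \<open>u\<close>.\<close>
  define a1 where "a1 = a \<oplus> s \<otimes> c"
  have [simp]: "a1 \<in> carrier A" by (simp add: a1_def)
  have pa1 [simp]: "p \<otimes> a1 = p" by (simp add: a1_def r_distr assoc[OF ps])
  have lag1: "lagrangian a1 c" unfolding a1_def by (rule lagrangian_shear[OF lag s])
  define g where "g = \<one> \<oplus> N"
  define g' where "g' = \<one> \<ominus> N"
  have [simp]: "g \<in> carrier A" "g' \<in> carrier A" by (simp_all add: g_def g'_def)
  have gg: "g \<otimes> g' = \<one>" "g' \<otimes> g = \<one>"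
    by (simp_all add: g_def g'_def ring_simprules add_cancel)
  define a2 where "a2 = g \<otimes> a1"
  have [simp]: "a2 \<in> carrier A" by (simp add: a2_def)
  have pa2 [simp]: "p \<otimes> a2 = p"
    by (simp add: a2_def g_def l_distr r_distr)
  have Ea2: "E \<otimes> a2 = W \<otimes> a1"
    by (simp add: a2_def g_def W_def l_distr r_distr)
  have Ea2E [simp]: "E \<otimes> (a2 \<otimes> E) = u"
  proof -
    have "E \<otimes> (a2 \<otimes> E) = W \<otimes> (a1 \<otimes> E)" using Ea2 by (simp flip: m_assoc)
    also have "\<dots> = W \<otimes> (a \<otimes> E) \<oplus> W \<otimes> (s \<otimes> (c \<otimes> E))"
      by (simp add: a1_def l_distr r_distr m_assoc)
    also have "W \<otimes> (s \<otimes> (c \<otimes> E)) = V \<otimes> (c \<otimes> E)"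
      by (rule assoc[OF Ws]) auto
    also have "W \<otimes> (a \<otimes> E) \<oplus> V \<otimes> (c \<otimes> E) = u"
      by (simp add: u_def W_def b_def N_def V_def l_distr r_distr m_assoc a_assoc)
    finally show ?thesis .
  qed
  \<comment> \<open>Column operations with the pivot \<open>u\<close> turn row \<open>k\<close> into that of the identity: \<open>h'\<close> is the identity
    with row \<open>k\<close> replaced by row \<open>k\<close> of \<open>a2\<close>, and \<open>h\<close> is its inverse.  The rows in \<open>p\<close> have a zero in
    column \<open>k\<close>, so they do not change.\<close>
  define h where "h = q \<oplus> u' \<ominus> u' \<otimes> (a2 \<otimes> q)"
  define h' where "h' = q \<oplus> E \<otimes> a2"
  have [simp]: "h \<in> carrier A" "h' \<in> carrier A" by (simp_all add: h_def h'_def)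
  have E_a2_u': "E \<otimes> (a2 \<otimes> u') = E"
    by (metis Ea2E Eu'(1) uu' m_assoc C(2) \<open>a2 \<in> carrier A\<close> \<open>u' \<in> carrier A\<close> m_closed)
  have E_a2_h: "E \<otimes> (a2 \<otimes> h) = E"
  proof -
    have "E \<otimes> (a2 \<otimes> (u' \<otimes> (a2 \<otimes> q))) = E \<otimes> (a2 \<otimes> q)"
      using E_a2_u' by (metis m_assoc C(2) \<open>a2 \<in> carrier A\<close> \<open>u' \<in> carrier A\<close> \<open>q \<in> carrier A\<close> m_closed)
    then show ?thesis
      by (simp add: h_def ring_simprules E_a2_u')
  qed
  have ph: "p \<otimes> h = p" by (simp add: h_def ring_simprules)
  have hh: "h \<otimes> h' = \<one>"
  proof -
    have qh': "q \<otimes> h' = q" by (simp add: h'_def r_distr)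
    have "E \<otimes> h' = E \<otimes> a2" by (simp add: h'_def r_distr)
    then have u'h': "u' \<otimes> h' = u' \<otimes> a2"
      by (metis Eu'(2) m_assoc C(2) \<open>a2 \<in> carrier A\<close> \<open>u' \<in> carrier A\<close> \<open>h' \<in> carrier A\<close>)
    have "h \<otimes> h' = q \<oplus> u' \<otimes> a2 \<ominus> u' \<otimes> (a2 \<otimes> q)"
      by (simp add: h_def minus_eq l_distr l_minus m_assoc qh' u'h')
    also have "u' \<otimes> a2 = u' \<otimes> (a2 \<otimes> q) \<oplus> u' \<otimes> (a2 \<otimes> E)"
      by (simp flip: r_distr add: qE1)
    also have "u' \<otimes> (a2 \<otimes> E) = u' \<otimes> (E \<otimes> (a2 \<otimes> E))"
      by (simp del: Ea2E)
    also have "\<dots> = E" by simp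
    finally show ?thesis using qE1 by (simp add: ring_simprules add_cancel)
  qed
  have hh': "h' \<otimes> h = \<one>"
  proof -
    have "q \<otimes> h = q" by (simp add: h_def ring_simprules)
    then show ?thesis by (simp add: h'_def l_distr m_assoc E_a2_h qE1)
  qed
  have "p \<otimes> (a2 \<otimes> h) = p" by (simp add: assoc[OF pa2] ph)
  with E_a2_h have "(p \<oplus> E) \<otimes> (g \<otimes> a1 \<otimes> h) = p \<oplus> E"
    by (simp add: l_distr flip: a2_def)
  then have "shiftable (g \<otimes> a1 \<otimes> h) (star g' \<otimes> c \<otimes> h)"
    using IH lagrangian_conj[OF lag1 _ _ _ _ gg hh hh'] by simp
  then have "shiftable a1 c"
    by (rule shiftable_conj[OF _ _ _ _ _ _ _ gg hh hh']) auto
  then show ?thesis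
    unfolding a1_def by (rule shiftable_shear[OF _ s]) auto
qed

text \<open>The steps run from \<open>p 0 = 0\<close>, where \<open>p a = p\<close> is no condition, to \<open>p n = 1\<close>, where it forces \<open>a = 1\<close>.\<close>
theorem shiftable_of_chain:
  fixes p :: "nat \<Rightarrow> 'a"
  assumes p0: "p 0 = \<zero>" and pn: "p n = \<one>"
    and pc: "\<And>k. k \<le> n \<Longrightarrow> p k \<in> carrier A" and ps: "\<And>k. k \<le> n \<Longrightarrow> star (p k) = p k"
    and pp: "\<And>k. k \<le> n \<Longrightarrow> p k \<otimes> p k = p k"
    and pS: "\<And>k. k < n \<Longrightarrow> p k \<otimes> p (Suc k) = p k"
    and sym: "\<And>k x. k < n \<Longrightarrow> x \<in> corner (p (Suc k) \<ominus> p k) \<Longrightarrow> star x = x"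
    and sr: "\<And>k x a b. \<lbrakk>k < n; x \<in> corner (p (Suc k) \<ominus> p k); a \<in> corner (p (Suc k) \<ominus> p k);
        b \<in> corner (p (Suc k) \<ominus> p k); x \<otimes> a \<oplus> b = p (Suc k) \<ominus> p k\<rbrakk>
      \<Longrightarrow> \<exists>t\<in>corner (p (Suc k) \<ominus> p k). \<exists>u\<in>corner (p (Suc k) \<ominus> p k).
            (a \<oplus> t \<otimes> b) \<otimes> u = p (Suc k) \<ominus> p k"
    and lag: "lagrangian a c"
  shows "shiftable a c"
proof -
  have "shiftable a c" if "k \<le> n" "lagrangian a c" "p k \<otimes> a = p k" for k a c
    using that
  proof (induction k arbitrary: a c rule: inc_induct)
    case base
    then have "a = \<one>" "c \<in> carrier A" by (auto simp: pn lagrangian_def)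
    then show ?case unfolding shiftable_def
      by (intro bexI[of _ \<zero>]) (auto simp: sym_elements_def)
  next
    case (step k)
    have [simp]: "p k \<in> carrier A" "p (Suc k) \<in> carrier A"
      "star (p k) = p k" "star (p (Suc k)) = p (Suc k)"
      "p k \<otimes> p k = p k" "p (Suc k) \<otimes> p (Suc k) = p (Suc k)" "p k \<otimes> p (Suc k) = p k"
      using step.hyps pc ps pp pS by auto
    have [simp]: "p (Suc k) \<otimes> p k = p k"
      using star_mult[of "p k" "p (Suc k)"] by simp
    have sum: "p k \<oplus> (p (Suc k) \<ominus> p k) = p (Suc k)"
      by (simp add: minus_eq add_cancel)
    show ?case
    proof (rule shiftable_step[of "p k" "p (Suc k) \<ominus> p k"])
      show "star x = x" if "x \<in> corner (p (Suc k) \<ominus> p k)" for x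
        using sym step.hyps that by blast
      show "\<exists>t\<in>corner (p (Suc k) \<ominus> p k). \<exists>u\<in>corner (p (Suc k) \<ominus> p k).
            (a \<oplus> t \<otimes> b) \<otimes> u = p (Suc k) \<ominus> p k"
        if "x \<in> corner (p (Suc k) \<ominus> p k)" "a \<in> corner (p (Suc k) \<ominus> p k)"
        "b \<in> corner (p (Suc k) \<ominus> p k)" "x \<otimes> a \<oplus> b = p (Suc k) \<ominus> p k" for x a b
        using sr step.hyps that by blast
      show "lagrangian a c" "p k \<otimes> a = p k" by fact+
      show "shiftable a c"
        if "lagrangian a c" "(p k \<oplus> (p (Suc k) \<ominus> p k)) \<otimes> a = p k \<oplus> (p (Suc k) \<ominus> p k)" for a c
        using step.IH that by (simp add: sum)
    qed (simp_all add: ring_simprules star_add star_minus)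
  qed
  from this[of 0 a c] lag show ?thesis
    by (simp add: p0 lagrangian_def)
qed

lemma star_euclidean_if_shiftable:
  assumes "\<And>a c. lagrangian a c \<Longrightarrow> shiftable a c"
  shows "star_euclidean A star"
  unfolding star_euclidean_def
proof (intro conjI ballI impI)
  show "ring_with_involution A star" by unfold_locales
next
  fix a c
  assume C [simp]: "a \<in> carrier A" "c \<in> carrier A"
    and uni: "(carrier A #> a) <+> (carrier A #> c) = carrier A"
    and "star a \<otimes> c \<in> sym_elements A star"
  then have "star a \<otimes> c = star c \<otimes> a"
    by (simp add: sym_elements_def star_simps)
  moreover have "\<one> \<in> (carrier A #> a) <+> (carrier A #> c)"
    using uni by simp
  then have "\<exists>x\<in>carrier A. \<exists>y\<in>carrier A. x \<otimes> a \<oplus> y \<otimes> c = \<one>"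
    unfolding set_add_def set_mult_def r_coset_def by fastforce
  ultimately have "shiftable a c"
    by (intro assms) (simp add: lagrangian_def)
  then obtain s where s: "s \<in> carrier A" "star s = s" and u: "a \<oplus> s \<otimes> c \<in> Units A"
    by (auto simp: shiftable_def sym_elements_def)
  define r where "r = (\<lambda>i::nat. if i = 0 then a else if i = 1 then c else a \<oplus> s \<otimes> c)"
  have "a = \<ominus> s \<otimes> c \<oplus> (a \<oplus> s \<otimes> c)"
    using s by (simp add: ring_simprules)
  then have "r 0 = a \<and> r 1 = c \<and> (\<forall>i<1. \<ominus> s \<in> sym_elements A star) \<and>
      (\<forall>i\<le>1. r i \<in> carrier A) \<and> r (1 + 1) \<in> Units A \<and>
      (\<forall>i<1. r i = \<ominus> s \<otimes> r (i + 1) \<oplus> r (i + 2))"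
    using s u by (auto simp: r_def sym_elements_def star_minus)
  then show "\<exists>m\<ge>1. \<exists>s r :: nat \<Rightarrow> 'a. r 0 = a \<and> r 1 = c \<and>
      (\<forall>i<m. s i \<in> sym_elements A star) \<and> (\<forall>i\<le>m. r i \<in> carrier A) \<and> r (m + 1) \<in> Units A \<and>
      (\<forall>i<m. r i = s i \<otimes> r (i + 1) \<oplus> r (i + 2))"
    by (intro exI[of _ 1] exI[of _ "\<lambda>_. \<ominus> s"] exI[of _ r] conjI) auto
qed

end

section \<open>Matrix rings over a commutative ring of stable range one\<close>
definition stable_range_one :: "('a, 'm) ring_scheme \<Rightarrow> bool" where
  "stable_range_one R \<longleftrightarrow> (\<forall>x\<in>carrier R. \<forall>a\<in>carrier R. \<forall>y\<in>carrier R. \<forall>b\<in>carrier R.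
     x \<otimes>\<^bsub>R\<^esub> a \<oplus>\<^bsub>R\<^esub> y \<otimes>\<^bsub>R\<^esub> b = \<one>\<^bsub>R\<^esub> \<longrightarrow> (\<exists>t\<in>carrier R. a \<oplus>\<^bsub>R\<^esub> t \<otimes>\<^bsub>R\<^esub> b \<in> Units R))"

lemma carrier_matrix_ring:
  "M \<in> carrier (matrix_ring n R) \<longleftrightarrow>
     M \<in> carrier_mat n n \<and> (\<forall>i<n. \<forall>j<n. M $$ (i, j) \<in> carrier R)"
  by (auto simp: matrix_ring_def elements_mat_def SUP_le_iff image_subset_iff)

lemma matrix_ring_simps:
  "M \<otimes>\<^bsub>matrix_ring n R\<^esub> N = mat n n (\<lambda>(i, j). \<Oplus>\<^bsub>R\<^esub>k\<in>{..<n}. M $$ (i, k) \<otimes>\<^bsub>R\<^esub> N $$ (k, j))"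
  "M \<oplus>\<^bsub>matrix_ring n R\<^esub> N = mat n n (\<lambda>(i, j). M $$ (i, j) \<oplus>\<^bsub>R\<^esub> N $$ (i, j))"
  "\<one>\<^bsub>matrix_ring n R\<^esub> = mat n n (\<lambda>(i, j). if i = j then \<one>\<^bsub>R\<^esub> else \<zero>\<^bsub>R\<^esub>)"
  "\<zero>\<^bsub>matrix_ring n R\<^esub> = mat n n (\<lambda>(i, j). \<zero>\<^bsub>R\<^esub>)"
  by (simp_all add: matrix_ring_def)

lemma matrix_ring_eqI:
  assumes "M \<in> carrier (matrix_ring n R)" "N \<in> carrier (matrix_ring n R)"
    and "\<And>i j. i < n \<Longrightarrow> j < n \<Longrightarrow> M $$ (i, j) = N $$ (i, j)"
  shows "M = N"
  using assms by (intro eq_matI) (auto simp: carrier_matrix_ring)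

context ring
begin

lemma finsum_swap:
  assumes "finite S" "finite T" "\<And>i j. i \<in> S \<Longrightarrow> j \<in> T \<Longrightarrow> f i j \<in> carrier R"
  shows "(\<Oplus>i\<in>S. \<Oplus>j\<in>T. f i j) = (\<Oplus>j\<in>T. \<Oplus>i\<in>S. f i j)"
  using assms(1,3)
proof (induction S rule: finite_induct)
  case empty
  then show ?case using assms(2) by simp
next
  case (insert x S)
  have "(\<Oplus>i\<in>insert x S. \<Oplus>j\<in>T. f i j) = (\<Oplus>j\<in>T. f x j) \<oplus> (\<Oplus>j\<in>T. \<Oplus>i\<in>S. f i j)"
    using insert by (subst finsum_insert) (auto intro!: finsum_closed)
  also have "\<dots> = (\<Oplus>j\<in>T. f x j \<oplus> (\<Oplus>i\<in>S. f i j))"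
    using insert by (subst finsum_addf) (auto intro!: finsum_closed)
  also have "\<dots> = (\<Oplus>j\<in>T. \<Oplus>i\<in>insert x S. f i j)"
    using insert by (intro finsum_cong') (auto intro!: finsum_closed simp: finsum_insert Pi_def)
  finally show ?case .
qed

lemma finsum_delta:
  assumes "finite S" "k \<in> S" "f \<in> S \<rightarrow> carrier R"
  shows "(\<Oplus>i\<in>S. if i = k then f i else \<zero>) = f k"
  using finsum_singleton[OF assms(2,1,3)] by (simp add: eq_commute)

lemma matrix_mult_closed:
  assumes "M \<in> carrier (matrix_ring n R)" "N \<in> carrier (matrix_ring n R)"
  shows "M \<otimes>\<^bsub>matrix_ring n R\<^esub> N \<in> carrier (matrix_ring n R)"
  using assms by (auto simp: carrier_matrix_ring matrix_ring_simps intro!: finsum_closed)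

text \<open>Interchanging the two summations is the only point beyond distributivity.\<close>
lemma matrix_mult_assoc:
  assumes "L \<in> carrier (matrix_ring n R)" "M \<in> carrier (matrix_ring n R)" "N \<in> carrier (matrix_ring n R)"
  shows "L \<otimes>\<^bsub>matrix_ring n R\<^esub> M \<otimes>\<^bsub>matrix_ring n R\<^esub> N
       = L \<otimes>\<^bsub>matrix_ring n R\<^esub> (M \<otimes>\<^bsub>matrix_ring n R\<^esub> N)"
proof (rule matrix_ring_eqI[of _ n R])
  fix i j assume ij: "i < n" "j < n"
  have C: "L $$ (i, k) \<in> carrier R" "M $$ (k, l) \<in> carrier R" "N $$ (l, j) \<in> carrier R"
    if "k < n" "l < n" for k l
    using assms ij that by (auto simp: carrier_matrix_ring)
  have "(\<Oplus>k\<in>{..<n}. (\<Oplus>l\<in>{..<n}. L $$ (i, l) \<otimes> M $$ (l, k)) \<otimes> N $$ (k, j))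
      = (\<Oplus>k\<in>{..<n}. \<Oplus>l\<in>{..<n}. L $$ (i, l) \<otimes> M $$ (l, k) \<otimes> N $$ (k, j))"
    by (intro finsum_cong' finsum_ldistr) (auto intro!: finsum_closed simp: C)
  also have "\<dots> = (\<Oplus>l\<in>{..<n}. \<Oplus>k\<in>{..<n}. L $$ (i, l) \<otimes> M $$ (l, k) \<otimes> N $$ (k, j))"
    by (rule finsum_swap) (auto simp: C)
  also have "\<dots> = (\<Oplus>l\<in>{..<n}. \<Oplus>k\<in>{..<n}. L $$ (i, l) \<otimes> (M $$ (l, k) \<otimes> N $$ (k, j)))"
    by (intro finsum_cong' refl) (auto intro!: finsum_closed m_assoc simp: C)
  also have "\<dots> = (\<Oplus>l\<in>{..<n}. L $$ (i, l) \<otimes> (\<Oplus>k\<in>{..<n}. M $$ (l, k) \<otimes> N $$ (k, j)))"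
    by (intro finsum_cong' finsum_rdistr[symmetric] refl) (auto intro!: finsum_closed simp: C)
  also have "\<dots> = (L \<otimes>\<^bsub>matrix_ring n R\<^esub> (M \<otimes>\<^bsub>matrix_ring n R\<^esub> N)) $$ (i, j)"
    using ij by (auto simp: matrix_ring_simps C intro!: finsum_cong' finsum_closed)
  also have "(\<Oplus>k\<in>{..<n}. (\<Oplus>l\<in>{..<n}. L $$ (i, l) \<otimes> M $$ (l, k)) \<otimes> N $$ (k, j))
      = (L \<otimes>\<^bsub>matrix_ring n R\<^esub> M \<otimes>\<^bsub>matrix_ring n R\<^esub> N) $$ (i, j)"
    using ij by (auto simp: matrix_ring_simps C intro!: finsum_cong' finsum_closed)
  finally show "(L \<otimes>\<^bsub>matrix_ring n R\<^esub> M \<otimes>\<^bsub>matrix_ring n R\<^esub> N) $$ (i, j)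
      = (L \<otimes>\<^bsub>matrix_ring n R\<^esub> (M \<otimes>\<^bsub>matrix_ring n R\<^esub> N)) $$ (i, j)" .
qed (intro matrix_mult_closed assms)+

definition diag01 :: "nat \<Rightarrow> nat set \<Rightarrow> 'a mat" where
  "diag01 n S = mat n n (\<lambda>(i, j). if i = j \<and> i \<in> S then \<one> else \<zero>)"

lemma diag01_closed: "diag01 n S \<in> carrier (matrix_ring n R)"
  by (auto simp: diag01_def carrier_matrix_ring)

lemma diag01_mult:
  assumes "M \<in> carrier (matrix_ring n R)"
  shows "diag01 n S \<otimes>\<^bsub>matrix_ring n R\<^esub> M = mat n n (\<lambda>(i, j). if i \<in> S then M $$ (i, j) else \<zero>)"
proof (rule matrix_ring_eqI[of _ n R])
  show "diag01 n S \<otimes>\<^bsub>matrix_ring n R\<^esub> M \<in> carrier (matrix_ring n R)"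
    by (intro matrix_mult_closed diag01_closed assms)
  show "mat n n (\<lambda>(i, j). if i \<in> S then M $$ (i, j) else \<zero>) \<in> carrier (matrix_ring n R)"
    using assms by (auto simp: carrier_matrix_ring)
  fix i j assume ij: "i < n" "j < n"
  then have C: "M $$ (k, j) \<in> carrier R" if "k < n" for k
    using assms that by (auto simp: carrier_matrix_ring)
  have "(\<Oplus>k\<in>{..<n}. diag01 n S $$ (i, k) \<otimes> M $$ (k, j))
      = (\<Oplus>k\<in>{..<n}. if k = i then (if i \<in> S then M $$ (k, j) else \<zero>) else \<zero>)"
    using ij C by (intro finsum_cong') (auto simp: diag01_def)
  also have "\<dots> = (if i \<in> S then M $$ (i, j) else \<zero>)"
    using ij C by (intro finsum_delta) auto
  finally show "(diag01 n S \<otimes>\<^bsub>matrix_ring n R\<^esub> M) $$ (i, j)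
      = mat n n (\<lambda>(i, j). if i \<in> S then M $$ (i, j) else \<zero>) $$ (i, j)"
    using ij by (simp add: matrix_ring_simps)
qed

lemma mult_diag01:
  assumes "M \<in> carrier (matrix_ring n R)"
  shows "M \<otimes>\<^bsub>matrix_ring n R\<^esub> diag01 n S = mat n n (\<lambda>(i, j). if j \<in> S then M $$ (i, j) else \<zero>)"
proof (rule matrix_ring_eqI[of _ n R])
  show "M \<otimes>\<^bsub>matrix_ring n R\<^esub> diag01 n S \<in> carrier (matrix_ring n R)"
    by (intro matrix_mult_closed diag01_closed assms)
  show "mat n n (\<lambda>(i, j). if j \<in> S then M $$ (i, j) else \<zero>) \<in> carrier (matrix_ring n R)"
    using assms by (auto simp: carrier_matrix_ring)
  fix i j assume ij: "i < n" "j < n"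
  then have C: "M $$ (i, k) \<in> carrier R" if "k < n" for k
    using assms that by (auto simp: carrier_matrix_ring)
  have "(\<Oplus>k\<in>{..<n}. M $$ (i, k) \<otimes> diag01 n S $$ (k, j))
      = (\<Oplus>k\<in>{..<n}. if k = j then (if j \<in> S then M $$ (i, k) else \<zero>) else \<zero>)"
    using ij C by (intro finsum_cong') (auto simp: diag01_def)
  also have "\<dots> = (if j \<in> S then M $$ (i, j) else \<zero>)"
    using ij C by (intro finsum_delta) auto
  finally show "(M \<otimes>\<^bsub>matrix_ring n R\<^esub> diag01 n S) $$ (i, j)
      = mat n n (\<lambda>(i, j). if j \<in> S then M $$ (i, j) else \<zero>) $$ (i, j)"
    using ij by (simp add: matrix_ring_simps)
qed

lemma one_eq_diag01: "\<one>\<^bsub>matrix_ring n R\<^esub> = diag01 n {..<n}"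
  by (auto simp: diag01_def matrix_ring_simps)

lemma matrix_ring_is_ring: "ring (matrix_ring n R)"
proof (rule ringI)
  let ?M = "matrix_ring n R"
  show "abelian_group ?M"
  proof (rule abelian_groupI)
    show "\<exists>N\<in>carrier ?M. N \<oplus>\<^bsub>?M\<^esub> M = \<zero>\<^bsub>?M\<^esub>" if "M \<in> carrier ?M" for M
      using that
      by (intro bexI[of _ "mat n n (\<lambda>(i, j). \<ominus> M $$ (i, j))"])
        (auto simp: carrier_matrix_ring matrix_ring_simps l_neg)
  qed (auto simp: carrier_matrix_ring matrix_ring_simps a_assoc a_comm a_lcomm intro!: eq_matI)
  show "monoid ?M"
  proof (rule monoidI)
    fix M assume M: "M \<in> carrier ?M"
    show "\<one>\<^bsub>?M\<^esub> \<otimes>\<^bsub>?M\<^esub> M = M" "M \<otimes>\<^bsub>?M\<^esub> \<one>\<^bsub>?M\<^esub> = M"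
      using M by (auto simp: one_eq_diag01 diag01_mult mult_diag01 carrier_matrix_ring)
  qed (auto simp: one_eq_diag01 diag01_closed intro: matrix_mult_closed matrix_mult_assoc)
  fix L M N
  assume C: "L \<in> carrier ?M" "M \<in> carrier ?M" "N \<in> carrier ?M"
  then have E: "L $$ (i, j) \<in> carrier R" "M $$ (i, j) \<in> carrier R" "N $$ (i, j) \<in> carrier R"
    if "i < n" "j < n" for i j
    using that by (auto simp: carrier_matrix_ring)
  show "(L \<oplus>\<^bsub>?M\<^esub> M) \<otimes>\<^bsub>?M\<^esub> N = L \<otimes>\<^bsub>?M\<^esub> N \<oplus>\<^bsub>?M\<^esub> M \<otimes>\<^bsub>?M\<^esub> N"
  proof (rule eq_matI, goal_cases)
    case (1 i j)
    then have ij: "i < n" "j < n" by (simp_all add: matrix_ring_simps)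
    then have "(\<Oplus>k\<in>{..<n}. L $$ (i, k) \<otimes> N $$ (k, j) \<oplus> M $$ (i, k) \<otimes> N $$ (k, j))
        = (\<Oplus>k\<in>{..<n}. L $$ (i, k) \<otimes> N $$ (k, j)) \<oplus> (\<Oplus>k\<in>{..<n}. M $$ (i, k) \<otimes> N $$ (k, j))"
      by (intro finsum_addf) (auto simp: E)
    moreover have "(\<Oplus>k\<in>{..<n}. (L $$ (i, k) \<oplus> M $$ (i, k)) \<otimes> N $$ (k, j))
        = (\<Oplus>k\<in>{..<n}. L $$ (i, k) \<otimes> N $$ (k, j) \<oplus> M $$ (i, k) \<otimes> N $$ (k, j))"
      using ij by (intro finsum_cong') (auto simp: E l_distr)
    moreover have "((L \<oplus>\<^bsub>?M\<^esub> M) \<otimes>\<^bsub>?M\<^esub> N) $$ (i, j) = (\<Oplus>k\<in>{..<n}. (L $$ (i, k) \<oplus> M $$ (i, k)) \<otimes> N $$ (k, j))"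
      using ij by (auto simp: matrix_ring_simps E intro!: finsum_cong')
    ultimately show ?case using ij by (simp add: matrix_ring_simps)
  qed (simp_all add: matrix_ring_simps)
  show "N \<otimes>\<^bsub>?M\<^esub> (L \<oplus>\<^bsub>?M\<^esub> M) = N \<otimes>\<^bsub>?M\<^esub> L \<oplus>\<^bsub>?M\<^esub> N \<otimes>\<^bsub>?M\<^esub> M"
  proof (rule eq_matI, goal_cases)
    case (1 i j)
    then have ij: "i < n" "j < n" by (simp_all add: matrix_ring_simps)
    then have "(\<Oplus>k\<in>{..<n}. N $$ (i, k) \<otimes> L $$ (k, j) \<oplus> N $$ (i, k) \<otimes> M $$ (k, j))
        = (\<Oplus>k\<in>{..<n}. N $$ (i, k) \<otimes> L $$ (k, j)) \<oplus> (\<Oplus>k\<in>{..<n}. N $$ (i, k) \<otimes> M $$ (k, j))"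
      by (intro finsum_addf) (auto simp: E)
    moreover have "(\<Oplus>k\<in>{..<n}. N $$ (i, k) \<otimes> (L $$ (k, j) \<oplus> M $$ (k, j)))
        = (\<Oplus>k\<in>{..<n}. N $$ (i, k) \<otimes> L $$ (k, j) \<oplus> N $$ (i, k) \<otimes> M $$ (k, j))"
      using ij by (intro finsum_cong') (auto simp: E r_distr)
    moreover have "(N \<otimes>\<^bsub>?M\<^esub> (L \<oplus>\<^bsub>?M\<^esub> M)) $$ (i, j) = (\<Oplus>k\<in>{..<n}. N $$ (i, k) \<otimes> (L $$ (k, j) \<oplus> M $$ (k, j)))"
      using ij by (auto simp: matrix_ring_simps E intro!: finsum_cong')
    ultimately show ?case using ij by (simp add: matrix_ring_simps)
  qed (simp_all add: matrix_ring_simps)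
qed

end

context cring
begin

lemma matrix_ring_with_involution: "ring_with_involution (matrix_ring n R) transpose_mat"
proof (intro ring_with_involution.intro ring_with_involution_axioms.intro matrix_ring_is_ring)
  let ?M = "matrix_ring n R"
  fix M N assume C: "M \<in> carrier ?M" "N \<in> carrier ?M"
  then have E: "M $$ (i, j) \<in> carrier R" "N $$ (i, j) \<in> carrier R"
    if "i < n" "j < n" for i j
    using that by (auto simp: carrier_matrix_ring)
  show "transpose_mat (M \<oplus>\<^bsub>?M\<^esub> N) = transpose_mat M \<oplus>\<^bsub>?M\<^esub> transpose_mat N"
    using C by (auto simp: carrier_matrix_ring matrix_ring_simps intro!: eq_matI)
  show "transpose_mat (M \<otimes>\<^bsub>?M\<^esub> N) = transpose_mat N \<otimes>\<^bsub>?M\<^esub> transpose_mat M"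
    using C by (auto simp: carrier_matrix_ring matrix_ring_simps E m_comm intro!: eq_matI finsum_cong')
qed (auto simp: carrier_matrix_ring)

text \<open>The corner at a diagonal matrix unit is a copy of the coefficient ring, embedded by putting a
  scalar at position \<open>(k, k)\<close>.  Such matrices are fixed by transposition.\<close>
lemma single_entry_corner:
  assumes "k < n" and M: "M \<in> ring_with_involution.corner (matrix_ring n R) (diag01 n {k})"
  shows "M $$ (k, k) \<in> carrier R" "M = mat n n (\<lambda>(i, j). if i = k \<and> j = k then M $$ (k, k) else \<zero>)"
proof -
  interpret M: ring_with_involution "matrix_ring n R" transpose_mat
    by (rule matrix_ring_with_involution)
  have C: "M \<in> carrier (matrix_ring n R)"
    and eq: "diag01 n {k} \<otimes>\<^bsub>matrix_ring n R\<^esub> M = M" "M \<otimes>\<^bsub>matrix_ring n R\<^esub> diag01 n {k} = M"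
    using M by (auto simp: M.corner_def)
  show "M $$ (k, k) \<in> carrier R"
    using assms(1) C by (auto simp: carrier_matrix_ring)
  have "M $$ (i, j) = \<zero>" if "i < n" "j < n" "i \<noteq> k" for i j
    using arg_cong[OF eq(1), of "\<lambda>N. N $$ (i, j)"] that by (simp add: diag01_mult[OF C])
  moreover have "M $$ (i, j) = \<zero>" if "i < n" "j < n" "j \<noteq> k" for i j
    using arg_cong[OF eq(2), of "\<lambda>N. N $$ (i, j)"] that by (simp add: mult_diag01[OF C])
  ultimately show "M = mat n n (\<lambda>(i, j). if i = k \<and> j = k then M $$ (k, k) else \<zero>)"
    using C by (intro eq_matI) (auto simp: carrier_matrix_ring)
qed

abbreviation single :: "nat \<Rightarrow> nat \<Rightarrow> 'a \<Rightarrow> 'a mat" where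
  "single n k r \<equiv> mat n n (\<lambda>(i, j). if i = k \<and> j = k then r else \<zero>)"

lemma single_closed: "r \<in> carrier R \<Longrightarrow> single n k r \<in> carrier (matrix_ring n R)"
  by (auto simp: carrier_matrix_ring)

lemma single_one: "single n k \<one> = diag01 n {k}"
  by (auto simp: diag01_def)

lemma single_in_corner:
  assumes "r \<in> carrier R"
  shows "single n k r \<in> ring_with_involution.corner (matrix_ring n R) (diag01 n {k})"
proof -
  interpret M: ring_with_involution "matrix_ring n R" transpose_mat
    by (rule matrix_ring_with_involution)
  show ?thesis
    using single_closed[OF assms] by (auto simp: M.corner_def diag01_mult mult_diag01)
qed

lemma single_add:
  assumes "r \<in> carrier R" "r' \<in> carrier R"
  shows "single n k r \<oplus>\<^bsub>matrix_ring n R\<^esub> single n k r' = single n k (r \<oplus> r')"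
  using assms by (auto simp: matrix_ring_simps intro!: eq_matI)

lemma single_mult:
  assumes "k < n" "r \<in> carrier R" "r' \<in> carrier R"
  shows "single n k r \<otimes>\<^bsub>matrix_ring n R\<^esub> single n k r' = single n k (r \<otimes> r')"
proof (intro eq_matI)
  fix i j assume "i < dim_row (single n k (r \<otimes> r'))" "j < dim_col (single n k (r \<otimes> r'))"
  then have ij: "i < n" "j < n" by auto
  have "(\<Oplus>l\<in>{..<n}. single n k r $$ (i, l) \<otimes> single n k r' $$ (l, j))
      = (\<Oplus>l\<in>{..<n}. if l = k then (if i = k \<and> j = k then r \<otimes> r' else \<zero>) else \<zero>)"
    using assms ij by (intro finsum_cong') auto
  also have "\<dots> = (if i = k \<and> j = k then r \<otimes> r' else \<zero>)"
    using assms by (intro finsum_delta) auto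
  finally show "(single n k r \<otimes>\<^bsub>matrix_ring n R\<^esub> single n k r') $$ (i, j) = single n k (r \<otimes> r') $$ (i, j)"
    using ij by (simp add: matrix_ring_simps)
qed (auto simp: matrix_ring_simps)

text \<open>The chain of idempotents projects to the first \<open>k\<close> coordinates, for \<open>k = 0, \<dots>, n\<close>.\<close>
theorem star_euclidean_matrix_ring:
  assumes sr: "stable_range_one R"
  shows "star_euclidean (matrix_ring n R) transpose_mat"
proof -
  interpret M: ring_with_involution "matrix_ring n R" transpose_mat
    by (rule matrix_ring_with_involution)
  define p where "p k = diag01 n {..<k}" for k
  have E: "p (Suc k) \<ominus>\<^bsub>matrix_ring n R\<^esub> p k = diag01 n {k}" if "k < n" for k
  proof -
    have "p (Suc k) = diag01 n {k} \<oplus>\<^bsub>matrix_ring n R\<^esub> p k"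
      by (auto simp: p_def diag01_def matrix_ring_simps intro!: eq_matI)
    then show ?thesis
      by (simp add: p_def diag01_closed M.a_assoc M.minus_eq M.r_neg)
  qed
  have "M.shiftable a c" if "M.lagrangian a c" for a c
  proof (rule M.shiftable_of_chain[OF _ _ _ _ _ _ _ _ that, of p n])
    show "p 0 = \<zero>\<^bsub>matrix_ring n R\<^esub>" "p n = \<one>\<^bsub>matrix_ring n R\<^esub>"
      by (auto simp: p_def one_eq_diag01) (auto simp: diag01_def matrix_ring_simps)
    show "p k \<in> carrier (matrix_ring n R)" for k
      by (simp add: p_def diag01_closed)
    show "transpose_mat (p k) = p k" for k
      by (auto simp: p_def diag01_def)
    show "p k \<otimes>\<^bsub>matrix_ring n R\<^esub> p k = p k" "p k \<otimes>\<^bsub>matrix_ring n R\<^esub> p (Suc k) = p k" for k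
      by (auto simp: p_def diag01_mult diag01_closed) (auto simp: diag01_def)
  next
    fix k M
    assume k: "k < n" and "M \<in> M.corner (p (Suc k) \<ominus>\<^bsub>matrix_ring n R\<^esub> p k)"
    then have "M = single n k (M $$ (k, k))"
      using single_entry_corner E by simp
    moreover have "transpose_mat (single n k r) = single n k r" for r
      by (intro eq_matI) auto
    ultimately show "transpose_mat M = M" by metis
  next
    fix k L A B
    assume k: "k < n"
      and c: "L \<in> M.corner (p (Suc k) \<ominus>\<^bsub>matrix_ring n R\<^esub> p k)"
        "A \<in> M.corner (p (Suc k) \<ominus>\<^bsub>matrix_ring n R\<^esub> p k)"
        "B \<in> M.corner (p (Suc k) \<ominus>\<^bsub>matrix_ring n R\<^esub> p k)"
      and eq: "L \<otimes>\<^bsub>matrix_ring n R\<^esub> A \<oplus>\<^bsub>matrix_ring n R\<^esub> B = p (Suc k) \<ominus>\<^bsub>matrix_ring n R\<^esub> p k"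
    define x a b where "x = L $$ (k, k)" and "a = A $$ (k, k)" and "b = B $$ (k, k)"
    have C: "x \<in> carrier R" "a \<in> carrier R" "b \<in> carrier R"
      using single_entry_corner(1)[OF k] c E[OF k] by (auto simp: x_def a_def b_def)
    have S: "L = single n k x" "A = single n k a" "B = single n k b"
      unfolding x_def a_def b_def
      by (rule single_entry_corner(2)[OF k], use c E[OF k] in simp)+
    have "single n k (x \<otimes> a \<oplus> b) = single n k \<one>"
      using eq k C by (simp add: S E single_mult single_add single_one)
    then have "single n k (x \<otimes> a \<oplus> b) $$ (k, k) = single n k \<one> $$ (k, k)" by simp
    then have "x \<otimes> a \<oplus> \<one> \<otimes> b = \<one>" using k C by simp
    then obtain t where t: "t \<in> carrier R" "a \<oplus> t \<otimes> b \<in> Units R"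
      using sr C unfolding stable_range_one_def by blast
    define u where "u = inv (a \<oplus> t \<otimes> b)"
    have u: "u \<in> carrier R" "(a \<oplus> t \<otimes> b) \<otimes> u = \<one>"
      using t by (auto simp: u_def)
    have "(A \<oplus>\<^bsub>matrix_ring n R\<^esub> single n k t \<otimes>\<^bsub>matrix_ring n R\<^esub> B) \<otimes>\<^bsub>matrix_ring n R\<^esub> single n k u
        = single n k ((a \<oplus> t \<otimes> b) \<otimes> u)"
      using k C t(1) u(1) by (simp add: S single_mult single_add)
    also have "\<dots> = diag01 n {k}" unfolding u(2) by (rule single_one)
    finally show "\<exists>T\<in>M.corner (p (Suc k) \<ominus>\<^bsub>matrix_ring n R\<^esub> p k).
        \<exists>U\<in>M.corner (p (Suc k) \<ominus>\<^bsub>matrix_ring n R\<^esub> p k).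
          (A \<oplus>\<^bsub>matrix_ring n R\<^esub> T \<otimes>\<^bsub>matrix_ring n R\<^esub> B) \<otimes>\<^bsub>matrix_ring n R\<^esub> U
          = p (Suc k) \<ominus>\<^bsub>matrix_ring n R\<^esub> p k"
      unfolding E[OF k] using single_in_corner[OF t(1)] single_in_corner[OF u(1)] by blast
  qed
  then show ?thesis by (rule M.star_euclidean_if_shiftable)
qed

end

section \<open>Valued fields and their completions\<close>
lemma null_real_seq_if_le:
  fixes g h :: "nat \<Rightarrow> real"
  assumes "h \<longlonglongrightarrow> 0" "\<And>i. \<bar>g i\<bar> \<le> h i"
  shows "g \<longlonglongrightarrow> 0"
proof (rule tendsto_0_le[OF assms(1), of _ 1])
  show "\<forall>\<^sub>F i in sequentially. norm (g i) \<le> norm (h i) * 1"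
    using assms(2) by (intro always_eventually allI) (metis abs_ge_self mult.right_neutral order_trans real_norm_def)
qed

locale valued_field = field F for F (structure) +
  fixes f :: "'a \<Rightarrow> real"
  assumes absolute_value: "absolute_value F f"
begin

lemma
  shows abs_nonneg: "x \<in> carrier F \<Longrightarrow> 0 \<le> f x"
    and abs_eq_zero_iff: "x \<in> carrier F \<Longrightarrow> f x = 0 \<longleftrightarrow> x = \<zero>"
    and abs_mult: "x \<in> carrier F \<Longrightarrow> y \<in> carrier F \<Longrightarrow> f (x \<otimes> y) = f x * f y"
    and abs_add: "x \<in> carrier F \<Longrightarrow> y \<in> carrier F \<Longrightarrow> f (x \<oplus> y) \<le> f x + f y"
  using absolute_value by (simp_all add: absolute_value_def)

lemma abs_zero [simp]: "f \<zero> = 0"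
  by (simp add: abs_eq_zero_iff)

lemma abs_one [simp]: "f \<one> = 1"
  using abs_mult[of \<one> \<one>] abs_eq_zero_iff[of \<one>] by simp

lemma abs_minus [simp]:
  assumes "x \<in> carrier F"
  shows "f (\<ominus> x) = f x"
proof -
  have "f (\<ominus> \<one>) * f (\<ominus> \<one>) = 1"
    using abs_mult[of "\<ominus> \<one>" "\<ominus> \<one>"] by (simp add: l_minus)
  then have "f (\<ominus> \<one>) = 1"
    using abs_nonneg[of "\<ominus> \<one>"] by (metis abs_square_eq_1 abs_of_nonneg a_inv_closed one_closed power2_eq_square)
  then show ?thesis
    using abs_mult[of "\<ominus> \<one>" x] assms by (simp add: l_minus)
qed

lemma abs_inv: "x \<in> carrier F \<Longrightarrow> x \<noteq> \<zero> \<Longrightarrow> f (inv x) = 1 / f x"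
  using abs_mult[of x "inv x"] abs_eq_zero_iff[of x] field_Units
  by (auto simp: field_simps)

lemma abs_diff: "x \<in> carrier F \<Longrightarrow> y \<in> carrier F \<Longrightarrow> f (x \<ominus> y) \<le> f x + f y"
  using abs_add[of x "\<ominus> y"] by (simp add: minus_eq)

lemma abs_abs_diff:
  assumes "x \<in> carrier F" "y \<in> carrier F"
  shows "\<bar>f x - f y\<bar> \<le> f (x \<ominus> y)"
proof -
  have "x = (x \<ominus> y) \<oplus> y" "y = \<ominus> (x \<ominus> y) \<oplus> x"
    using assms by (simp_all add: ring_simprules add_cancel)
  then have "f x \<le> f (x \<ominus> y) + f y" "f y \<le> f (x \<ominus> y) + f x"
    using abs_add[of "x \<ominus> y" y] abs_add[of "\<ominus> (x \<ominus> y)" x] assms by simp_all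
  then show ?thesis by linarith
qed

text \<open>The same \<open>t\<close> has to serve the field and, when the data are integral, its valuation ring.  In the
  latter \<open>\<bar>a\<bar> < 1\<close> gives \<open>\<bar>x a\<bar> < 1\<close>, so \<open>\<bar>y b\<bar> = 1\<close> and \<open>\<bar>b\<bar> = 1\<close>, and then \<open>\<bar>a + b\<bar> = 1\<close> by the
  ultrametric inequality.\<close>
lemma shift_to_unit:
  assumes C: "x \<in> carrier F" "a \<in> carrier F" "y \<in> carrier F" "b \<in> carrier F"
    and eq: "x \<otimes> a \<oplus> y \<otimes> b = \<one>"
  shows "\<exists>t\<in>{\<zero>, \<one>}. a \<oplus> t \<otimes> b \<noteq> \<zero> \<and>
    (nonarchimedean F f \<and> f x \<le> 1 \<and> f a \<le> 1 \<and> f y \<le> 1 \<and> f b \<le> 1 \<longrightarrow> f (a \<oplus> t \<otimes> b) = 1)"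
proof (cases "nonarchimedean F f \<and> f x \<le> 1 \<and> f a \<le> 1 \<and> f y \<le> 1 \<and> f b \<le> 1 \<and> f a \<noteq> 1")
  case True
  then have ultra: "f (u \<oplus> v) \<le> max (f u) (f v)" if "u \<in> carrier F" "v \<in> carrier F" for u v
    using that by (simp add: nonarchimedean_def)
  have "f x * f a < 1"
    using True mult_left_le_one_le[of "f a" "f x"] abs_nonneg C by force
  moreover have "1 \<le> max (f x * f a) (f y * f b)"
    using ultra[of "x \<otimes> a" "y \<otimes> b"] C by (simp add: eq abs_mult)
  ultimately have "1 \<le> f y * f b" by simp
  then have "f b = 1"
    using True mult_left_le_one_le[of "f b" "f y"] abs_nonneg C by force
  moreover have "b = (a \<oplus> b) \<oplus> \<ominus> a"
    using C by (simp add: ring_simprules add_cancel)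
  then have "f b \<le> max (f (a \<oplus> b)) (f a)"
    using ultra[of "a \<oplus> b" "\<ominus> a"] C by simp
  moreover have "f (a \<oplus> b) \<le> max (f a) (f b)"
    using ultra C by simp
  ultimately have "f (a \<oplus> b) = 1" using True by auto
  then show ?thesis
    using C by (intro bexI[of _ \<one>]) auto
next
  case False
  show ?thesis
  proof (cases "a = \<zero>")
    case True
    with eq C have "b \<noteq> \<zero>" by auto
    then show ?thesis using True False C by (intro bexI[of _ \<one>]) auto
  next
    case a: False
    then show ?thesis using False C by (intro bexI[of _ \<zero>]) auto
  qed
qed

lemma cauchy_seqsI:
  assumes "\<And>i. \<xi> i \<in> carrier F"
    and "\<And>e. e > 0 \<Longrightarrow> \<exists>N. \<forall>i\<ge>N. \<forall>j\<ge>N. f (\<xi> i \<ominus> \<xi> j) < e"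
  shows "\<xi> \<in> cauchy_seqs F f"
  using assms by (simp add: cauchy_seqs_def)

lemma cauchy_seqs_carrier: "\<xi> \<in> cauchy_seqs F f \<Longrightarrow> \<xi> i \<in> carrier F"
  by (simp add: cauchy_seqs_def)

lemma cauchy_seqsD:
  "\<xi> \<in> cauchy_seqs F f \<Longrightarrow> e > 0 \<Longrightarrow> \<exists>N. \<forall>i\<ge>N. \<forall>j\<ge>N. f (\<xi> i \<ominus> \<xi> j) < e"
  by (simp add: cauchy_seqs_def)

lemma abs_convergent:
  assumes "\<xi> \<in> cauchy_seqs F f"
  shows "convergent (\<lambda>i. f (\<xi> i))"
proof -
  have "Cauchy (\<lambda>i. f (\<xi> i))"
  proof (rule CauchyI)
    fix e :: real assume "0 < e"
    then obtain N where "\<forall>i\<ge>N. \<forall>j\<ge>N. f (\<xi> i \<ominus> \<xi> j) < e"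
      using cauchy_seqsD assms by blast
    then have "\<forall>i\<ge>N. \<forall>j\<ge>N. norm (f (\<xi> i) - f (\<xi> j)) < e"
      using abs_abs_diff cauchy_seqs_carrier[OF assms]
      by (metis order_le_less_trans real_norm_def)
    then show "\<exists>M. \<forall>m\<ge>M. \<forall>n\<ge>M. norm (f (\<xi> m) - f (\<xi> n)) < e" by blast
  qed
  then show ?thesis by (rule real_Cauchy_convergent)
qed

lemma abs_bounded:
  assumes "\<xi> \<in> cauchy_seqs F f"
  obtains B where "B > 0" "\<And>i. f (\<xi> i) \<le> B"
proof -
  have "Bseq (\<lambda>i. f (\<xi> i))"
    using abs_convergent[OF assms] by (simp add: convergent_imp_Bseq)
  then obtain B where "B > 0" "\<And>i. norm (f (\<xi> i)) \<le> B"
    by (auto elim: BseqE)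
  then show ?thesis
    using that by (metis abs_ge_self order_trans real_norm_def)
qed

lemma const_cauchy: "x \<in> carrier F \<Longrightarrow> (\<lambda>i. x) \<in> cauchy_seqs F f"
  by (simp add: cauchy_seqs_def minus_eq r_neg)

lemma add_cauchy:
  assumes "\<xi> \<in> cauchy_seqs F f" "\<eta> \<in> cauchy_seqs F f"
  shows "(\<lambda>i. \<xi> i \<oplus> \<eta> i) \<in> cauchy_seqs F f"
proof (rule cauchy_seqsI)
  note [simp] = cauchy_seqs_carrier[OF assms(1)] cauchy_seqs_carrier[OF assms(2)]
  show "\<xi> i \<oplus> \<eta> i \<in> carrier F" for i by simp
  fix e :: real assume "e > 0"
  then have "e / 2 > 0" by simp
  then obtain N M where N: "\<And>i j. i \<ge> N \<Longrightarrow> j \<ge> N \<Longrightarrow> f (\<xi> i \<ominus> \<xi> j) < e / 2"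
    and M: "\<And>i j. i \<ge> M \<Longrightarrow> j \<ge> M \<Longrightarrow> f (\<eta> i \<ominus> \<eta> j) < e / 2"
    using cauchy_seqsD[OF assms(1)] cauchy_seqsD[OF assms(2)] by metis
  have "f ((\<xi> i \<oplus> \<eta> i) \<ominus> (\<xi> j \<oplus> \<eta> j)) < e" if "i \<ge> max N M" "j \<ge> max N M" for i j
  proof -
    have "(\<xi> i \<oplus> \<eta> i) \<ominus> (\<xi> j \<oplus> \<eta> j) = (\<xi> i \<ominus> \<xi> j) \<oplus> (\<eta> i \<ominus> \<eta> j)"
      by (simp add: ring_simprules)
    then have "f ((\<xi> i \<oplus> \<eta> i) \<ominus> (\<xi> j \<oplus> \<eta> j)) \<le> f (\<xi> i \<ominus> \<xi> j) + f (\<eta> i \<ominus> \<eta> j)"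
      by (simp add: abs_add)
    then show ?thesis using N[of i j] M[of i j] that by simp
  qed
  then show "\<exists>N. \<forall>i\<ge>N. \<forall>j\<ge>N. f (\<xi> i \<oplus> \<eta> i \<ominus> (\<xi> j \<oplus> \<eta> j)) < e" by blast
qed

lemma mult_cauchy:
  assumes "\<xi> \<in> cauchy_seqs F f" "\<eta> \<in> cauchy_seqs F f"
  shows "(\<lambda>i. \<xi> i \<otimes> \<eta> i) \<in> cauchy_seqs F f"
proof (rule cauchy_seqsI)
  note [simp] = cauchy_seqs_carrier[OF assms(1)] cauchy_seqs_carrier[OF assms(2)]
  show "\<xi> i \<otimes> \<eta> i \<in> carrier F" for i by simp
  fix e :: real assume "e > 0"
  obtain A B where A: "A > 0" "\<And>i. f (\<xi> i) \<le> A" and B: "B > 0" "\<And>i. f (\<eta> i) \<le> B"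
    using abs_bounded[OF assms(1)] abs_bounded[OF assms(2)] by metis
  have "e / (2 * B) > 0" "e / (2 * A) > 0" using \<open>e > 0\<close> A B by auto
  then obtain N M where N: "\<And>i j. i \<ge> N \<Longrightarrow> j \<ge> N \<Longrightarrow> f (\<xi> i \<ominus> \<xi> j) < e / (2 * B)"
    and M: "\<And>i j. i \<ge> M \<Longrightarrow> j \<ge> M \<Longrightarrow> f (\<eta> i \<ominus> \<eta> j) < e / (2 * A)"
    using cauchy_seqsD[OF assms(1)] cauchy_seqsD[OF assms(2)] by metis
  have "f (\<xi> i \<otimes> \<eta> i \<ominus> \<xi> j \<otimes> \<eta> j) < e" if "i \<ge> max N M" "j \<ge> max N M" for i j
  proof -
    have "\<xi> i \<otimes> \<eta> i \<ominus> \<xi> j \<otimes> \<eta> j = \<xi> i \<otimes> (\<eta> i \<ominus> \<eta> j) \<oplus> (\<xi> i \<ominus> \<xi> j) \<otimes> \<eta> j"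
      by (simp add: ring_simprules)
    then have "f (\<xi> i \<otimes> \<eta> i \<ominus> \<xi> j \<otimes> \<eta> j) \<le> f (\<xi> i) * f (\<eta> i \<ominus> \<eta> j) + f (\<xi> i \<ominus> \<xi> j) * f (\<eta> j)"
      using abs_add[of "\<xi> i \<otimes> (\<eta> i \<ominus> \<eta> j)" "(\<xi> i \<ominus> \<xi> j) \<otimes> \<eta> j"] by (simp add: abs_mult)
    also have "\<dots> \<le> A * f (\<eta> i \<ominus> \<eta> j) + f (\<xi> i \<ominus> \<xi> j) * B"
      by (intro add_mono mult_mono A B abs_nonneg) (use A in auto)
    also have "\<dots> < A * (e / (2 * A)) + e / (2 * B) * B"
      by (intro add_strict_mono mult_strict_left_mono mult_strict_right_mono) (use A B N M that in auto)
    also have "\<dots> = e" using A B by simp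
    finally show ?thesis .
  qed
  then show "\<exists>N. \<forall>i\<ge>N. \<forall>j\<ge>N. f (\<xi> i \<otimes> \<eta> i \<ominus> \<xi> j \<otimes> \<eta> j) < e" by blast
qed

lemma minus_cauchy:
  assumes "\<xi> \<in> cauchy_seqs F f"
  shows "(\<lambda>i. \<ominus> \<xi> i) \<in> cauchy_seqs F f"
  using mult_cauchy[OF const_cauchy[of "\<ominus> \<one>"] assms] cauchy_seqs_carrier[OF assms]
  by (simp add: l_minus)

lemma cauchy_ring_simps:
  "carrier (cauchy_ring F f) = cauchy_seqs F f"
  "\<xi> \<otimes>\<^bsub>cauchy_ring F f\<^esub> \<eta> = (\<lambda>i. \<xi> i \<otimes> \<eta> i)"
  "\<xi> \<oplus>\<^bsub>cauchy_ring F f\<^esub> \<eta> = (\<lambda>i. \<xi> i \<oplus> \<eta> i)"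
  "\<one>\<^bsub>cauchy_ring F f\<^esub> = (\<lambda>i. \<one>)"
  "\<zero>\<^bsub>cauchy_ring F f\<^esub> = (\<lambda>i. \<zero>)"
  by (simp_all add: cauchy_ring_def)

lemma cauchy_ring_is_cring: "cring (cauchy_ring F f)"
proof (rule cringI)
  show "abelian_group (cauchy_ring F f)"
  proof (rule abelian_groupI)
    fix \<xi> assume "\<xi> \<in> carrier (cauchy_ring F f)"
    then show "\<exists>\<eta>\<in>carrier (cauchy_ring F f). \<eta> \<oplus>\<^bsub>cauchy_ring F f\<^esub> \<xi> = \<zero>\<^bsub>cauchy_ring F f\<^esub>"
      by (intro bexI[of _ "\<lambda>i. \<ominus> \<xi> i"])
        (auto simp: cauchy_ring_simps minus_cauchy cauchy_seqs_carrier l_neg)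
  qed (auto simp: cauchy_ring_simps add_cauchy const_cauchy cauchy_seqs_carrier a_ac)
  show "comm_monoid (cauchy_ring F f)"
    by (rule comm_monoidI)
      (auto simp: cauchy_ring_simps mult_cauchy const_cauchy cauchy_seqs_carrier m_ac)
qed (auto simp: cauchy_ring_simps cauchy_seqs_carrier l_distr)

lemma null_cauchy:
  assumes "\<xi> \<in> null_seqs F f"
  shows "\<xi> \<in> cauchy_seqs F f"
proof (rule cauchy_seqsI)
  show C: "\<xi> i \<in> carrier F" for i using assms by (simp add: null_seqs_def)
  fix e :: real assume "e > 0"
  then have "e / 2 > 0" by simp
  then obtain N where N: "\<forall>i\<ge>N. norm (f (\<xi> i) - 0) < e / 2"
    using assms LIMSEQ_D[of "\<lambda>i. f (\<xi> i)" 0] unfolding null_seqs_def by blast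
  have "f (\<xi> i \<ominus> \<xi> j) < e" if "i \<ge> N" "j \<ge> N" for i j
  proof -
    have "f (\<xi> i) < e / 2" "f (\<xi> j) < e / 2" using N that by force+
    then show ?thesis using abs_diff[OF C[of i] C[of j]] by linarith
  qed
  then show "\<exists>N. \<forall>i\<ge>N. \<forall>j\<ge>N. f (\<xi> i \<ominus> \<xi> j) < e" by blast
qed

lemma null_add:
  assumes "\<xi> \<in> null_seqs F f" "\<eta> \<in> null_seqs F f"
  shows "(\<lambda>i. \<xi> i \<oplus> \<eta> i) \<in> null_seqs F f"
proof -
  have C: "\<xi> i \<in> carrier F" "\<eta> i \<in> carrier F" for i
    using assms by (auto simp: null_seqs_def)
  have "(\<lambda>i. f (\<xi> i) + f (\<eta> i)) \<longlonglongrightarrow> 0"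
    using assms by (auto simp: null_seqs_def intro: tendsto_add_zero)
  then have "(\<lambda>i. f (\<xi> i \<oplus> \<eta> i)) \<longlonglongrightarrow> 0"
    by (rule null_real_seq_if_le[of "\<lambda>i. f (\<xi> i) + f (\<eta> i)"])
      (simp add: C abs_add abs_nonneg)
  then show ?thesis using C by (simp add: null_seqs_def)
qed

lemma null_mult:
  assumes "\<xi> \<in> cauchy_seqs F f" "\<eta> \<in> null_seqs F f"
  shows "(\<lambda>i. \<xi> i \<otimes> \<eta> i) \<in> null_seqs F f"
proof -
  have C: "\<xi> i \<in> carrier F" "\<eta> i \<in> carrier F" for i
    using assms cauchy_seqs_carrier by (auto simp: null_seqs_def)
  obtain L where "(\<lambda>i. f (\<xi> i)) \<longlonglongrightarrow> L"
    using abs_convergent[OF assms(1)] by (auto simp: convergent_def)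
  then have "(\<lambda>i. f (\<xi> i) * f (\<eta> i)) \<longlonglongrightarrow> L * 0"
    using assms by (intro tendsto_mult) (auto simp: null_seqs_def)
  then show ?thesis using C by (simp add: null_seqs_def abs_mult)
qed

lemma null_seqs_ideal: "ideal (null_seqs F f) (cauchy_ring F f)"
proof -
  interpret R: cring "cauchy_ring F f" by (rule cauchy_ring_is_cring)
  have C: "\<xi> i \<in> carrier F" if "\<xi> \<in> null_seqs F f" for \<xi> i
    using that by (simp add: null_seqs_def)
  show ?thesis
  proof (rule idealI)
    show "ring (cauchy_ring F f)" by unfold_locales
    show "subgroup (null_seqs F f) (add_monoid (cauchy_ring F f))"
    proof
      show "null_seqs F f \<subseteq> carrier (add_monoid (cauchy_ring F f))"
        using null_cauchy by (auto simp: cauchy_ring_simps)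
      show "\<one>\<^bsub>add_monoid (cauchy_ring F f)\<^esub> \<in> null_seqs F f"
        by (simp add: cauchy_ring_simps null_seqs_def)
      fix \<xi> assume \<xi>: "\<xi> \<in> null_seqs F f"
      show "\<xi> \<otimes>\<^bsub>add_monoid (cauchy_ring F f)\<^esub> \<eta> \<in> null_seqs F f" if "\<eta> \<in> null_seqs F f" for \<eta>
        using null_add \<xi> that by (simp add: cauchy_ring_simps)
      have "\<ominus>\<^bsub>cauchy_ring F f\<^esub> \<xi> = (\<lambda>i. \<ominus> \<xi> i)"
        using \<xi> null_cauchy[OF \<xi>] minus_cauchy[OF null_cauchy[OF \<xi>]]
        by (intro R.minus_equality) (auto simp: cauchy_ring_simps C l_neg)
      moreover have "(\<lambda>i. \<ominus> \<xi> i) \<in> null_seqs F f"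
        using \<xi> by (simp add: null_seqs_def)
      ultimately show "inv\<^bsub>add_monoid (cauchy_ring F f)\<^esub> \<xi> \<in> null_seqs F f"
        by (simp add: a_inv_def)
    qed
    fix \<xi> \<eta> assume "\<xi> \<in> null_seqs F f" "\<eta> \<in> carrier (cauchy_ring F f)"
    then have \<xi>: "\<xi> \<in> null_seqs F f" and \<eta>: "\<eta> \<in> cauchy_seqs F f"
      by (auto simp: cauchy_ring_simps)
    then show "\<eta> \<otimes>\<^bsub>cauchy_ring F f\<^esub> \<xi> \<in> null_seqs F f"
      by (simp add: cauchy_ring_simps null_mult)
    then show "\<xi> \<otimes>\<^bsub>cauchy_ring F f\<^esub> \<eta> \<in> null_seqs F f"
      using C[OF \<xi>] cauchy_seqs_carrier[OF \<eta>] by (simp add: cauchy_ring_simps m_comm)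
  qed
qed

text \<open>A Cauchy sequence as an element of the completion.\<close>
definition limit :: "(nat \<Rightarrow> 'a) \<Rightarrow> (nat \<Rightarrow> 'a) set" where
  "limit \<xi> = null_seqs F f +>\<^bsub>cauchy_ring F f\<^esub> \<xi>"

lemma completion_cring: "cring (completion F f)"
  unfolding completion_def
  by (rule ideal.quotient_is_cring[OF null_seqs_ideal cauchy_ring_is_cring])

lemma carrier_completion: "carrier (completion F f) = limit ` cauchy_seqs F f"
  by (auto simp: completion_def FactRing_def A_RCOSETS_def' limit_def cauchy_ring_simps)

lemma
  assumes "\<xi> \<in> cauchy_seqs F f" "\<eta> \<in> cauchy_seqs F f"
  shows limit_mult: "limit \<xi> \<otimes>\<^bsub>completion F f\<^esub> limit \<eta> = limit (\<lambda>i. \<xi> i \<otimes> \<eta> i)"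
    and limit_add: "limit \<xi> \<oplus>\<^bsub>completion F f\<^esub> limit \<eta> = limit (\<lambda>i. \<xi> i \<oplus> \<eta> i)"
  using ring_hom_mult[OF ideal.rcos_ring_hom[OF null_seqs_ideal], of \<xi> \<eta>]
    ring_hom_add[OF ideal.rcos_ring_hom[OF null_seqs_ideal], of \<xi> \<eta>] assms
  by (simp_all add: completion_def limit_def cauchy_ring_simps)

lemma limit_one: "\<one>\<^bsub>completion F f\<^esub> = limit (\<lambda>i. \<one>)"
  using ring_hom_one[OF ideal.rcos_ring_hom[OF null_seqs_ideal]]
  by (simp add: completion_def limit_def cauchy_ring_simps)

lemma completion_zero: "\<zero>\<^bsub>completion F f\<^esub> = null_seqs F f"
  by (simp add: completion_def FactRing_def)

lemma mem_limit_iff: "\<eta> \<in> limit \<xi> \<longleftrightarrow> (\<exists>\<nu>\<in>null_seqs F f. \<eta> = (\<lambda>i. \<nu> i \<oplus> \<xi> i))"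
  by (auto simp: limit_def a_r_coset_def' cauchy_ring_simps)

lemma null_zero: "(\<lambda>i. \<zero>) \<in> null_seqs F f"
  by (simp add: null_seqs_def)

lemma limit_self: "\<xi> \<in> cauchy_seqs F f \<Longrightarrow> \<xi> \<in> limit \<xi>"
  unfolding mem_limit_iff by (intro bexI[OF _ null_zero]) (simp add: cauchy_seqs_carrier)

lemma limit_eq_zero_iff:
  assumes "\<xi> \<in> cauchy_seqs F f"
  shows "limit \<xi> = \<zero>\<^bsub>completion F f\<^esub> \<longleftrightarrow> \<xi> \<in> null_seqs F f"
proof
  assume "limit \<xi> = \<zero>\<^bsub>completion F f\<^esub>"
  with limit_self[OF assms] show "\<xi> \<in> null_seqs F f" by (simp add: completion_zero)
next
  assume "\<xi> \<in> null_seqs F f"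
  then show "limit \<xi> = \<zero>\<^bsub>completion F f\<^esub>"
    using ideal.Icarr[OF null_seqs_ideal]
      abelian_subgroup.a_rcos_const[OF abelian_subgroupI3[OF ideal.axioms(1)[OF null_seqs_ideal]]]
      cauchy_ring_is_cring
    by (simp add: completion_zero limit_def cring.axioms(1) ring.is_abelian_group)
qed

text \<open>The extension of the absolute value by continuity.  The choice of a Cauchy sequence in the class
  is immaterial by \<open>lim_abs_mem_limit\<close>.\<close>
definition completion_abs :: "(nat \<Rightarrow> 'a) set \<Rightarrow> real" where
  "completion_abs x = lim (\<lambda>i. f ((SOME \<xi>. \<xi> \<in> x) i))"

lemma lim_abs_mem_limit:
  assumes "\<xi> \<in> cauchy_seqs F f" "\<eta> \<in> limit \<xi>"
  shows "lim (\<lambda>i. f (\<eta> i)) = lim (\<lambda>i. f (\<xi> i))"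
proof -
  obtain \<nu> where \<nu>: "\<nu> \<in> null_seqs F f" and \<eta>: "\<eta> = (\<lambda>i. \<nu> i \<oplus> \<xi> i)"
    using assms mem_limit_iff by blast
  have C: "\<nu> i \<in> carrier F" "\<xi> i \<in> carrier F" for i
    using \<nu> cauchy_seqs_carrier[OF assms(1)] by (auto simp: null_seqs_def)
  have diff: "\<bar>f (\<eta> i) - f (\<xi> i)\<bar> \<le> f (\<nu> i)" for i
  proof -
    have "\<eta> i \<ominus> \<xi> i = \<nu> i" using C by (simp add: \<eta> ring_simprules)
    then show ?thesis using abs_abs_diff[of "\<eta> i" "\<xi> i"] C by (simp add: \<eta>)
  qed
  have "(\<lambda>i. f (\<nu> i)) \<longlonglongrightarrow> 0"
    using \<nu> by (simp add: null_seqs_def)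
  then have "(\<lambda>i. f (\<eta> i) - f (\<xi> i)) \<longlonglongrightarrow> 0"
    using diff by (rule null_real_seq_if_le)
  moreover have "(\<lambda>i. f (\<xi> i)) \<longlonglongrightarrow> lim (\<lambda>i. f (\<xi> i))"
    using abs_convergent[OF assms(1)] by (simp add: convergent_LIMSEQ_iff)
  ultimately have "(\<lambda>i. f (\<eta> i)) \<longlonglongrightarrow> lim (\<lambda>i. f (\<xi> i))"
    by (rule Lim_transform[rotated])
  then show ?thesis by (rule limI)
qed

lemma completion_abs_limit:
  assumes "\<xi> \<in> cauchy_seqs F f"
  shows "(\<lambda>i. f (\<xi> i)) \<longlonglongrightarrow> completion_abs (limit \<xi>)"
proof -
  have "(SOME \<eta>. \<eta> \<in> limit \<xi>) \<in> limit \<xi>"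
    using limit_self[OF assms] by (rule someI[of "\<lambda>\<eta>. \<eta> \<in> limit \<xi>"])
  then have "completion_abs (limit \<xi>) = lim (\<lambda>i. f (\<xi> i))"
    unfolding completion_abs_def by (rule lim_abs_mem_limit[OF assms])
  then show ?thesis
    using abs_convergent[OF assms] by (simp add: convergent_LIMSEQ_iff)
qed

lemma completion_integers_eq:
  "completion_integers F f = {x \<in> carrier (completion F f). completion_abs x \<le> 1}"
proof -
  have "(\<forall>\<eta>\<in>limit \<xi>. lim (\<lambda>i. f (\<eta> i)) \<le> 1) \<longleftrightarrow> completion_abs (limit \<xi>) \<le> 1"
    if "\<xi> \<in> cauchy_seqs F f" for \<xi>
    using that lim_abs_mem_limit[OF that] limit_self[OF that] limI[OF completion_abs_limit[OF that]]
    by auto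
  then show ?thesis
    unfolding completion_integers_def carrier_completion by auto
qed

text \<open>A Cauchy sequence that does not tend to zero is eventually bounded away from zero.  Inverting its
  terms from there on gives a Cauchy sequence, and the product of the two differs from one by a
  sequence with finitely many nonzero terms, which is null.\<close>
lemma completion_field: "field (completion F f)"
proof (rule cring.cring_fieldI2[OF completion_cring])
  have "(\<lambda>i. \<one>) \<notin> null_seqs F f"
    using LIMSEQ_unique[OF tendsto_const[of "1::real"], of 0] by (auto simp: null_seqs_def)
  then show "\<zero>\<^bsub>completion F f\<^esub> \<noteq> \<one>\<^bsub>completion F f\<^esub>"
    using limit_eq_zero_iff[OF const_cauchy[of \<one>]] by (simp add: limit_one)
  fix x assume "x \<in> carrier (completion F f)" and x0: "x \<noteq> \<zero>\<^bsub>completion F f\<^esub>"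
  then obtain \<xi> where \<xi>: "\<xi> \<in> cauchy_seqs F f" and x: "x = limit \<xi>"
    by (auto simp: carrier_completion)
  note [simp] = cauchy_seqs_carrier[OF \<xi>]
  define L where "L = completion_abs x"
  have L: "(\<lambda>i. f (\<xi> i)) \<longlonglongrightarrow> L"
    using completion_abs_limit[OF \<xi>] by (simp add: L_def x)
  have "L \<ge> 0" by (intro LIMSEQ_le_const[OF L] exI[of _ 0]) (simp add: abs_nonneg)
  moreover have "L \<noteq> 0"
    using x0 L limit_eq_zero_iff[OF \<xi>] by (auto simp: x null_seqs_def)
  ultimately have "L > 0" by simp
  then have "eventually (\<lambda>i. f (\<xi> i) > L / 2) sequentially"
    using order_tendstoD(1)[OF L, of "L / 2"] by simp
  then obtain M where M: "\<And>i. i \<ge> M \<Longrightarrow> f (\<xi> i) > L / 2"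
    by (auto simp: eventually_sequentially)
  have nz: "\<xi> i \<noteq> \<zero>" if "i \<ge> M" for i
    using M[OF that] \<open>L > 0\<close> by auto
  then have inv_mult: "inv (\<xi> i) \<in> carrier F" "\<xi> i \<otimes> inv (\<xi> i) = \<one>" if "i \<ge> M" for i
    using that field_Units by auto
  define \<eta> where "\<eta> i = (if i \<ge> M then inv (\<xi> i) else \<zero>)" for i
  have \<eta>C [simp]: "\<eta> i \<in> carrier F" for i
    by (simp add: \<eta>_def inv_mult)
  have \<eta>: "\<eta> \<in> cauchy_seqs F f"
  proof (rule cauchy_seqsI)
    fix e :: real assume "e > 0"
    then have "e * (L / 2 * (L / 2)) > 0" using \<open>L > 0\<close> by simp
    then obtain N where N: "\<And>i j. i \<ge> N \<Longrightarrow> j \<ge> N \<Longrightarrow> f (\<xi> i \<ominus> \<xi> j) < e * (L / 2 * (L / 2))"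
      using cauchy_seqsD[OF \<xi>] by metis
    have "f (\<eta> i \<ominus> \<eta> j) < e" if "i \<ge> max M N" "j \<ge> max M N" for i j
    proof -
      have ij: "\<xi> i \<otimes> \<eta> i = \<one>" "\<xi> j \<otimes> \<eta> j = \<one>"
        using that inv_mult by (auto simp: \<eta>_def)
      have "\<xi> i \<otimes> \<xi> j \<otimes> (\<eta> i \<ominus> \<eta> j) = \<xi> j \<otimes> (\<xi> i \<otimes> \<eta> i) \<ominus> \<xi> i \<otimes> (\<xi> j \<otimes> \<eta> j)"
        by (simp add: minus_eq r_distr r_minus m_ac)
      then have "\<xi> i \<otimes> \<xi> j \<otimes> (\<eta> i \<ominus> \<eta> j) = \<xi> j \<ominus> \<xi> i" by (simp add: ij)
      then have "f (\<xi> i) * f (\<xi> j) * f (\<eta> i \<ominus> \<eta> j) = f (\<xi> j \<ominus> \<xi> i)"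
        by (metis abs_mult m_closed minus_closed \<eta>C cauchy_seqs_carrier \<xi>)
      also have "\<dots> < e * (L / 2 * (L / 2))" using N that by simp
      also have "\<dots> \<le> e * (f (\<xi> i) * f (\<xi> j))"
        using \<open>e > 0\<close> \<open>L > 0\<close> M[of i] M[of j] that
        by (intro mult_left_mono mult_mono) auto
      finally have "f (\<xi> i) * f (\<xi> j) * f (\<eta> i \<ominus> \<eta> j) < f (\<xi> i) * f (\<xi> j) * e"
        by (simp add: mult.commute)
      then show ?thesis
        using abs_nonneg[of "\<xi> i"] abs_nonneg[of "\<xi> j"]
        by (meson mult_less_cancel_left mult_nonneg_nonneg cauchy_seqs_carrier \<xi> not_less)
    qed
    then show "\<exists>N. \<forall>i\<ge>N. \<forall>j\<ge>N. f (\<eta> i \<ominus> \<eta> j) < e" by blast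
  qed simp
  define \<nu> where "\<nu> i = (if i \<ge> M then \<zero> else \<one>)" for i
  have "\<forall>\<^sub>F i in sequentially. f (\<nu> i) = 0"
    by (auto simp: \<nu>_def eventually_sequentially)
  then have \<nu>: "\<nu> \<in> null_seqs F f"
    by (auto simp: null_seqs_def \<nu>_def tendsto_eventually)
  have "(\<lambda>i. \<nu> i \<oplus> \<xi> i \<otimes> \<eta> i) = (\<lambda>i. \<one>)"
    by (auto simp: \<nu>_def \<eta>_def inv_mult)
  then have "limit (\<lambda>i. \<one>) = limit \<nu> \<oplus>\<^bsub>completion F f\<^esub> limit (\<lambda>i. \<xi> i \<otimes> \<eta> i)"
    using limit_add[OF null_cauchy[OF \<nu>] mult_cauchy[OF \<xi> \<eta>]] by simp
  also have "limit \<nu> = \<zero>\<^bsub>completion F f\<^esub>"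
    using limit_eq_zero_iff null_cauchy \<nu> by blast
  also have "\<zero>\<^bsub>completion F f\<^esub> \<oplus>\<^bsub>completion F f\<^esub> limit (\<lambda>i. \<xi> i \<otimes> \<eta> i) = limit (\<lambda>i. \<xi> i \<otimes> \<eta> i)"
  proof -
    interpret K: cring "completion F f" by (rule completion_cring)
    show ?thesis using mult_cauchy[OF \<xi> \<eta>] by (simp add: carrier_completion)
  qed
  finally have "x \<otimes>\<^bsub>completion F f\<^esub> limit \<eta> = \<one>\<^bsub>completion F f\<^esub>"
    by (simp add: x limit_mult[OF \<xi> \<eta>] limit_one)
  then show "\<exists>y\<in>carrier (completion F f). x \<otimes>\<^bsub>completion F f\<^esub> y = \<one>\<^bsub>completion F f\<^esub>"
    using \<eta> by (auto simp: carrier_completion)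
qed

lemma completion_absolute_value: "absolute_value (completion F f) completion_abs"
  unfolding absolute_value_def carrier_completion
proof (intro conjI ballI; clarsimp)
  fix \<xi> assume \<xi>: "\<xi> \<in> cauchy_seqs F f"
  note lim\<xi> = completion_abs_limit[OF \<xi>]
  show "0 \<le> completion_abs (limit \<xi>)"
    by (intro LIMSEQ_le_const[OF lim\<xi>] exI[of _ 0]) (simp add: abs_nonneg cauchy_seqs_carrier[OF \<xi>])
  show "completion_abs (limit \<xi>) = 0 \<longleftrightarrow> limit \<xi> = \<zero>\<^bsub>completion F f\<^esub>"
    using lim\<xi> LIMSEQ_unique[OF lim\<xi>, of 0] limit_eq_zero_iff[OF \<xi>] cauchy_seqs_carrier[OF \<xi>]
    by (auto simp: null_seqs_def)
  fix \<eta> assume \<eta>: "\<eta> \<in> cauchy_seqs F f"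
  note lim\<eta> = completion_abs_limit[OF \<eta>]
  note C = cauchy_seqs_carrier[OF \<xi>] cauchy_seqs_carrier[OF \<eta>]
  show "completion_abs (limit \<xi> \<otimes>\<^bsub>completion F f\<^esub> limit \<eta>)
      = completion_abs (limit \<xi>) * completion_abs (limit \<eta>)"
    using LIMSEQ_unique[OF completion_abs_limit[OF mult_cauchy[OF \<xi> \<eta>]]] tendsto_mult[OF lim\<xi> lim\<eta>]
    by (simp add: limit_mult[OF \<xi> \<eta>] abs_mult C)
  show "completion_abs (limit \<xi> \<oplus>\<^bsub>completion F f\<^esub> limit \<eta>)
      \<le> completion_abs (limit \<xi>) + completion_abs (limit \<eta>)"
    unfolding limit_add[OF \<xi> \<eta>]
    by (rule LIMSEQ_le[OF completion_abs_limit[OF add_cauchy[OF \<xi> \<eta>]] tendsto_add[OF lim\<xi> lim\<eta>]])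
      (auto simp: abs_add C)
qed

lemma completion_nonarchimedean:
  assumes "nonarchimedean F f"
  shows "nonarchimedean (completion F f) completion_abs"
  unfolding nonarchimedean_def carrier_completion
proof (intro ballI; clarify)
  fix \<xi> \<eta> assume \<xi>: "\<xi> \<in> cauchy_seqs F f" and \<eta>: "\<eta> \<in> cauchy_seqs F f"
  show "completion_abs (limit \<xi> \<oplus>\<^bsub>completion F f\<^esub> limit \<eta>)
      \<le> max (completion_abs (limit \<xi>)) (completion_abs (limit \<eta>))"
    unfolding limit_add[OF \<xi> \<eta>]
    using assms cauchy_seqs_carrier[OF \<xi>] cauchy_seqs_carrier[OF \<eta>]
    by (intro LIMSEQ_le[OF completion_abs_limit[OF add_cauchy[OF \<xi> \<eta>]]
        tendsto_max[OF completion_abs_limit[OF \<xi>] completion_abs_limit[OF \<eta>]]])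
      (auto simp: nonarchimedean_def)
qed

end

section \<open>The ring of adeles\<close>
locale adelic_field = field F for F (structure)
begin

text \<open>An absolute value is equivalent to itself (exponent \<open>1\<close>), so a place is a nonempty class and the
  choice made by \<open>place_abs\<close> lies in it.\<close>
lemma place_abs:
  assumes "v \<in> places F"
  shows "absolute_value F (place_abs v)"
proof -
  from assms obtain f where f: "f \<in> nontrivial_absolute_values F"
    and v: "v = absolute_value_equiv F `` {f}"
    unfolding places_def by (rule quotientE)
  have "f x = f x powr 1" if "x \<in> carrier F" for x
    using f that by (auto simp: nontrivial_absolute_values_def absolute_value_def)
  then have "f \<in> v"
    using f unfolding v absolute_value_equiv_def by (auto intro!: exI[of _ "1::real"])
  then have "place_abs v \<in> v" unfolding place_abs_def by (rule someI[of "\<lambda>g. g \<in> v"])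
  moreover have "v \<subseteq> nontrivial_absolute_values F"
    by (auto simp: v absolute_value_equiv_def)
  ultimately have "place_abs v \<in> nontrivial_absolute_values F" by blast
  then show ?thesis by (simp add: nontrivial_absolute_values_def)
qed

abbreviation K :: "('a \<Rightarrow> real) set \<Rightarrow> (nat \<Rightarrow> 'a) set ring" where
  "K v \<equiv> completion F (place_abs v)"

definition local_abs :: "('a \<Rightarrow> real) set \<Rightarrow> (nat \<Rightarrow> 'a) set \<Rightarrow> real" where
  "local_abs v = valued_field.completion_abs (place_abs v)"

definition nonarchimedean_places :: "('a \<Rightarrow> real) set set" where
  "nonarchimedean_places = {v \<in> places F. nonarchimedean F (place_abs v)}"

lemma valued_field_completion:
  assumes "v \<in> places F"
  shows "valued_field (K v) (local_abs v)"
proof -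
  interpret V: valued_field F "place_abs v"
    by unfold_locales (rule place_abs[OF assms])
  show ?thesis
    unfolding local_abs_def valued_field_def valued_field_axioms_def
    using V.completion_field V.completion_absolute_value by simp
qed

lemma completion_integers_place:
  assumes "v \<in> places F"
  shows "completion_integers F (place_abs v) = {x \<in> carrier (K v). local_abs v x \<le> 1}"
proof -
  interpret V: valued_field F "place_abs v"
    by unfold_locales (rule place_abs[OF assms])
  show ?thesis unfolding local_abs_def by (rule V.completion_integers_eq)
qed

lemma nonarchimedean_completion:
  assumes "v \<in> nonarchimedean_places"
  shows "nonarchimedean (K v) (local_abs v)"
proof -
  have v: "v \<in> places F" "nonarchimedean F (place_abs v)"
    using assms by (simp_all add: nonarchimedean_places_def)
  interpret V: valued_field F "place_abs v"
    by unfold_locales (rule place_abs[OF v(1)])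
  show ?thesis unfolding local_abs_def by (rule V.completion_nonarchimedean[OF v(2)])
qed

definition nonintegral :: "(('a \<Rightarrow> real) set \<Rightarrow> (nat \<Rightarrow> 'a) set) \<Rightarrow> ('a \<Rightarrow> real) set set" where
  "nonintegral x = {v \<in> nonarchimedean_places. local_abs v (x v) > 1}"

lemma adele_iff:
  "x \<in> carrier (adele_ring F) \<longleftrightarrow> x \<in> extensional (places F) \<and>
     (\<forall>v\<in>places F. x v \<in> carrier (K v)) \<and> finite (nonintegral x)"
proof -
  have "{v \<in> places F. nonarchimedean F (place_abs v) \<and> x v \<notin> completion_integers F (place_abs v)}
      = nonintegral x" if "\<forall>v\<in>places F. x v \<in> carrier (K v)"
    using that by (auto simp: nonintegral_def nonarchimedean_places_def completion_integers_place)
  then show ?thesis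
    by (auto simp: adele_ring_def PiE_iff)
qed

lemma adele_ring_simps:
  "x \<otimes>\<^bsub>adele_ring F\<^esub> y = (\<lambda>v\<in>places F. x v \<otimes>\<^bsub>K v\<^esub> y v)"
  "x \<oplus>\<^bsub>adele_ring F\<^esub> y = (\<lambda>v\<in>places F. x v \<oplus>\<^bsub>K v\<^esub> y v)"
  "\<one>\<^bsub>adele_ring F\<^esub> = (\<lambda>v\<in>places F. \<one>\<^bsub>K v\<^esub>)"
  "\<zero>\<^bsub>adele_ring F\<^esub> = (\<lambda>v\<in>places F. \<zero>\<^bsub>K v\<^esub>)"
  by (simp_all add: adele_ring_def)

lemma nonarchimedean_placesD: "v \<in> nonarchimedean_places \<Longrightarrow> v \<in> places F"
  by (simp add: nonarchimedean_places_def)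

lemma adele_carrier: "x \<in> carrier (adele_ring F) \<Longrightarrow> v \<in> places F \<Longrightarrow> x v \<in> carrier (K v)"
  by (simp add: adele_iff)

text \<open>It is enough to name some finite set of places outside of which the components are integral.\<close>
lemma adeleI:
  assumes "\<And>v. v \<in> places F \<Longrightarrow> x v \<in> carrier (K v)" "finite B"
    and "\<And>v. v \<in> nonarchimedean_places \<Longrightarrow> v \<notin> B \<Longrightarrow> local_abs v (x v) \<le> 1"
  shows "(\<lambda>v\<in>places F. x v) \<in> carrier (adele_ring F)"
proof -
  have "nonintegral (\<lambda>v\<in>places F. x v) \<subseteq> B"
  proof
    fix v assume "v \<in> nonintegral (\<lambda>v\<in>places F. x v)"
    then have "v \<in> nonarchimedean_places" "local_abs v (x v) > 1"
      by (auto simp: nonintegral_def nonarchimedean_placesD)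
    then show "v \<in> B" using assms(3) by fastforce
  qed
  then show ?thesis
    using assms(1,2) by (simp add: adele_iff finite_subset)
qed

lemma adele_add_closed:
  assumes "x \<in> carrier (adele_ring F)" "y \<in> carrier (adele_ring F)"
  shows "x \<oplus>\<^bsub>adele_ring F\<^esub> y \<in> carrier (adele_ring F)"
  unfolding adele_ring_simps
proof (rule adeleI[where B = "nonintegral x \<union> nonintegral y"])
  note C = adele_carrier[OF assms(1)] adele_carrier[OF assms(2)]
  show "x v \<oplus>\<^bsub>K v\<^esub> y v \<in> carrier (K v)" if "v \<in> places F" for v
  proof -
    interpret V: valued_field "K v" "local_abs v" by (rule valued_field_completion[OF that])
    show ?thesis using C that by simp
  qed
  show "finite (nonintegral x \<union> nonintegral y)" using assms by (simp add: adele_iff)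
  fix v assume v: "v \<in> nonarchimedean_places" "v \<notin> nonintegral x \<union> nonintegral y"
  then have "local_abs v (x v \<oplus>\<^bsub>K v\<^esub> y v) \<le> max (local_abs v (x v)) (local_abs v (y v))"
    using nonarchimedean_completion C nonarchimedean_placesD by (simp add: nonarchimedean_def)
  then show "local_abs v (x v \<oplus>\<^bsub>K v\<^esub> y v) \<le> 1"
    using v by (auto simp: nonintegral_def)
qed

lemma adele_mult_closed:
  assumes "x \<in> carrier (adele_ring F)" "y \<in> carrier (adele_ring F)"
  shows "x \<otimes>\<^bsub>adele_ring F\<^esub> y \<in> carrier (adele_ring F)"
  unfolding adele_ring_simps
proof (rule adeleI[where B = "nonintegral x \<union> nonintegral y"])
  note C = adele_carrier[OF assms(1)] adele_carrier[OF assms(2)]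
  show "x v \<otimes>\<^bsub>K v\<^esub> y v \<in> carrier (K v)" if "v \<in> places F" for v
  proof -
    interpret V: valued_field "K v" "local_abs v" by (rule valued_field_completion[OF that])
    show ?thesis using C that by simp
  qed
  show "finite (nonintegral x \<union> nonintegral y)" using assms by (simp add: adele_iff)
  fix v assume v: "v \<in> nonarchimedean_places" "v \<notin> nonintegral x \<union> nonintegral y"
  interpret V: valued_field "K v" "local_abs v" by (rule valued_field_completion[OF nonarchimedean_placesD[OF v(1)]])
  have "local_abs v (x v) \<le> 1" "local_abs v (y v) \<le> 1"
    using v by (auto simp: nonintegral_def)
  then show "local_abs v (x v \<otimes>\<^bsub>K v\<^esub> y v) \<le> 1"
    using C[OF nonarchimedean_placesD[OF v(1)]] by (simp add: V.abs_mult V.abs_nonneg mult_le_one)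
qed

lemma adele_zero_closed: "\<zero>\<^bsub>adele_ring F\<^esub> \<in> carrier (adele_ring F)"
  unfolding adele_ring_simps
proof (rule adeleI[where B = "{}"])
  fix v assume v: "v \<in> places F"
  interpret V: valued_field "K v" "local_abs v" by (rule valued_field_completion[OF v])
  show "\<zero>\<^bsub>K v\<^esub> \<in> carrier (K v)" by simp
next
  fix v assume v: "v \<in> nonarchimedean_places"
  interpret V: valued_field "K v" "local_abs v" by (rule valued_field_completion[OF nonarchimedean_placesD[OF v]])
  show "local_abs v \<zero>\<^bsub>K v\<^esub> \<le> 1" by simp
qed simp

lemma adele_one_closed: "\<one>\<^bsub>adele_ring F\<^esub> \<in> carrier (adele_ring F)"
  unfolding adele_ring_simps
proof (rule adeleI[where B = "{}"])
  fix v assume v: "v \<in> places F"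
  interpret V: valued_field "K v" "local_abs v" by (rule valued_field_completion[OF v])
  show "\<one>\<^bsub>K v\<^esub> \<in> carrier (K v)" by simp
next
  fix v assume v: "v \<in> nonarchimedean_places"
  interpret V: valued_field "K v" "local_abs v" by (rule valued_field_completion[OF nonarchimedean_placesD[OF v]])
  show "local_abs v \<one>\<^bsub>K v\<^esub> \<le> 1" by simp
qed simp

lemma adele_neg_closed:
  assumes "x \<in> carrier (adele_ring F)"
  shows "(\<lambda>v\<in>places F. \<ominus>\<^bsub>K v\<^esub> x v) \<in> carrier (adele_ring F)"
proof (rule adeleI[where B = "nonintegral x"])
  fix v assume v: "v \<in> places F"
  interpret V: valued_field "K v" "local_abs v" by (rule valued_field_completion[OF v])
  show "\<ominus>\<^bsub>K v\<^esub> x v \<in> carrier (K v)" using adele_carrier[OF assms v] by simp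
next
  show "finite (nonintegral x)" using assms by (simp add: adele_iff)
  fix v assume v: "v \<in> nonarchimedean_places" "v \<notin> nonintegral x"
  interpret V: valued_field "K v" "local_abs v" by (rule valued_field_completion[OF nonarchimedean_placesD[OF v(1)]])
  show "local_abs v (\<ominus>\<^bsub>K v\<^esub> x v) \<le> 1"
    using v adele_carrier[OF assms nonarchimedean_placesD[OF v(1)]] by (auto simp: nonintegral_def)
qed

lemma adele_ring_cring: "cring (adele_ring F)"
proof (rule cringI)
  let ?R = "adele_ring F"
  have K: "cring (K v)" if "v \<in> places F" for v
    using valued_field_completion[OF that] by (simp add: valued_field_def fieldE(1))
  note C = adele_carrier and defs = adele_ring_simps
  note closed = adele_add_closed adele_mult_closed adele_zero_closed adele_one_closed
  show "abelian_group ?R"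
  proof (rule abelian_groupI)
    fix x y z assume x: "x \<in> carrier ?R" and y: "y \<in> carrier ?R" and z: "z \<in> carrier ?R"
    show "x \<oplus>\<^bsub>?R\<^esub> y \<oplus>\<^bsub>?R\<^esub> z = x \<oplus>\<^bsub>?R\<^esub> (y \<oplus>\<^bsub>?R\<^esub> z)"
      unfolding defs
      by (rule restrict_ext) (simp add: cring.cring_simprules(7)[OF K] C[OF x] C[OF y] C[OF z])
    show "x \<oplus>\<^bsub>?R\<^esub> y = y \<oplus>\<^bsub>?R\<^esub> x"
      unfolding defs by (rule restrict_ext) (rule cring.cring_simprules(10)[OF K C[OF x] C[OF y]])
  next
    fix x assume x: "x \<in> carrier ?R"
    show "\<zero>\<^bsub>?R\<^esub> \<oplus>\<^bsub>?R\<^esub> x = x"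
      by (rule extensionalityI[of _ "places F"])
        (use x in \<open>auto simp: defs adele_iff cring.cring_simprules(8)[OF K]\<close>)
    have "(\<lambda>v\<in>places F. \<ominus>\<^bsub>K v\<^esub> x v) \<oplus>\<^bsub>?R\<^esub> x = \<zero>\<^bsub>?R\<^esub>"
      unfolding defs by (rule restrict_ext) (simp add: cring.cring_simprules(9)[OF K] C[OF x])
    then show "\<exists>y\<in>carrier ?R. y \<oplus>\<^bsub>?R\<^esub> x = \<zero>\<^bsub>?R\<^esub>"
      using adele_neg_closed[OF x] by blast
  qed (simp_all add: closed)
  show "comm_monoid ?R"
  proof (rule comm_monoidI)
    fix x y z assume x: "x \<in> carrier ?R" and y: "y \<in> carrier ?R" and z: "z \<in> carrier ?R"
    show "x \<otimes>\<^bsub>?R\<^esub> y \<otimes>\<^bsub>?R\<^esub> z = x \<otimes>\<^bsub>?R\<^esub> (y \<otimes>\<^bsub>?R\<^esub> z)"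
      unfolding defs
      by (rule restrict_ext) (simp add: cring.cring_simprules(11)[OF K] C[OF x] C[OF y] C[OF z])
    show "x \<otimes>\<^bsub>?R\<^esub> y = y \<otimes>\<^bsub>?R\<^esub> x"
      unfolding defs by (rule restrict_ext) (rule cring.cring_simprules(14)[OF K C[OF x] C[OF y]])
  next
    fix x assume x: "x \<in> carrier ?R"
    show "\<one>\<^bsub>?R\<^esub> \<otimes>\<^bsub>?R\<^esub> x = x"
      by (rule extensionalityI[of _ "places F"])
        (use x in \<open>auto simp: defs adele_iff cring.cring_simprules(12)[OF K]\<close>)
  qed (simp_all add: closed)
  fix x y z assume x: "x \<in> carrier ?R" and y: "y \<in> carrier ?R" and z: "z \<in> carrier ?R"
  show "(x \<oplus>\<^bsub>?R\<^esub> y) \<otimes>\<^bsub>?R\<^esub> z = x \<otimes>\<^bsub>?R\<^esub> z \<oplus>\<^bsub>?R\<^esub> y \<otimes>\<^bsub>?R\<^esub> z"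
    unfolding defs
    by (rule restrict_ext) (simp add: cring.cring_simprules(13)[OF K] C[OF x] C[OF y] C[OF z])
qed

text \<open>Choosing \<open>t v\<close> in \<open>{0, 1}\<close> makes \<open>t\<close> integral everywhere.  Outside the finite set \<open>B\<close> where one of
  the given adeles fails to be integral, \<open>a + t b\<close> has absolute value one, and so does its inverse.\<close>
lemma adele_ring_stable_range_one: "stable_range_one (adele_ring F)"
  unfolding stable_range_one_def
proof (intro ballI impI)
  let ?R = "adele_ring F"
  interpret R: cring ?R by (rule adele_ring_cring)
  fix x a y b
  assume C: "x \<in> carrier ?R" "a \<in> carrier ?R" "y \<in> carrier ?R" "b \<in> carrier ?R"
    and eq: "x \<otimes>\<^bsub>?R\<^esub> a \<oplus>\<^bsub>?R\<^esub> y \<otimes>\<^bsub>?R\<^esub> b = \<one>\<^bsub>?R\<^esub>"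
  define B where "B = nonintegral x \<union> nonintegral a \<union> nonintegral y \<union> nonintegral b"
  have B: "finite B" using C by (simp add: B_def adele_iff)
  have "\<exists>t\<in>{\<zero>\<^bsub>K v\<^esub>, \<one>\<^bsub>K v\<^esub>}. a v \<oplus>\<^bsub>K v\<^esub> t \<otimes>\<^bsub>K v\<^esub> b v \<noteq> \<zero>\<^bsub>K v\<^esub> \<and>
      (v \<in> nonarchimedean_places \<and> v \<notin> B \<longrightarrow> local_abs v (a v \<oplus>\<^bsub>K v\<^esub> t \<otimes>\<^bsub>K v\<^esub> b v) = 1)"
    if v: "v \<in> places F" for v
  proof -
    interpret V: valued_field "K v" "local_abs v" by (rule valued_field_completion[OF v])
    have eqv: "x v \<otimes>\<^bsub>K v\<^esub> a v \<oplus>\<^bsub>K v\<^esub> y v \<otimes>\<^bsub>K v\<^esub> b v = \<one>\<^bsub>K v\<^esub>"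
      using arg_cong[OF eq, of "\<lambda>z. z v"] v by (simp add: adele_ring_simps)
    have "local_abs v (x v) \<le> 1 \<and> local_abs v (a v) \<le> 1 \<and> local_abs v (y v) \<le> 1 \<and> local_abs v (b v) \<le> 1"
      if "v \<in> nonarchimedean_places" "v \<notin> B"
      using that by (auto simp: B_def nonintegral_def)
    then show ?thesis
      using V.shift_to_unit[OF _ _ _ _ eqv] C v adele_carrier nonarchimedean_completion by blast
  qed
  then obtain t where t01: "\<And>v. v \<in> places F \<Longrightarrow> t v \<in> {\<zero>\<^bsub>K v\<^esub>, \<one>\<^bsub>K v\<^esub>}"
    and nz: "\<And>v. v \<in> places F \<Longrightarrow> a v \<oplus>\<^bsub>K v\<^esub> t v \<otimes>\<^bsub>K v\<^esub> b v \<noteq> \<zero>\<^bsub>K v\<^esub>"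
    and unit: "\<And>v. v \<in> nonarchimedean_places \<Longrightarrow> v \<notin> B \<Longrightarrow> local_abs v (a v \<oplus>\<^bsub>K v\<^esub> t v \<otimes>\<^bsub>K v\<^esub> b v) = 1"
    using nonarchimedean_placesD by metis
  define s where "s = (\<lambda>v\<in>places F. t v)"
  have s: "s \<in> carrier ?R" unfolding s_def
  proof (rule adeleI[where B = "{}"])
    fix v assume v: "v \<in> places F"
    interpret V: valued_field "K v" "local_abs v" by (rule valued_field_completion[OF v])
    show "t v \<in> carrier (K v)" using t01[OF v] by auto
  next
    fix v assume v: "v \<in> nonarchimedean_places"
    interpret V: valued_field "K v" "local_abs v" by (rule valued_field_completion[OF nonarchimedean_placesD[OF v]])
    show "local_abs v (t v) \<le> 1" using t01[OF nonarchimedean_placesD[OF v]] by auto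
  qed simp
  define u where "u = a \<oplus>\<^bsub>?R\<^esub> s \<otimes>\<^bsub>?R\<^esub> b"
  have u: "u \<in> carrier ?R" using C s by (simp add: u_def)
  have uv: "u v = a v \<oplus>\<^bsub>K v\<^esub> t v \<otimes>\<^bsub>K v\<^esub> b v" if "v \<in> places F" for v
    using that by (simp add: u_def s_def adele_ring_simps)
  define u' where "u' = (\<lambda>v\<in>places F. inv\<^bsub>K v\<^esub> (u v))"
  have inv: "inv\<^bsub>K v\<^esub> (u v) \<in> carrier (K v)" "u v \<otimes>\<^bsub>K v\<^esub> inv\<^bsub>K v\<^esub> (u v) = \<one>\<^bsub>K v\<^esub>"
    if v: "v \<in> places F" for v
  proof -
    interpret V: valued_field "K v" "local_abs v" by (rule valued_field_completion[OF v])
    show "inv\<^bsub>K v\<^esub> (u v) \<in> carrier (K v)" "u v \<otimes>\<^bsub>K v\<^esub> inv\<^bsub>K v\<^esub> (u v) = \<one>\<^bsub>K v\<^esub>"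
      using nz[OF v] uv[OF v] adele_carrier[OF u v] V.field_Units by auto
  qed
  have u': "u' \<in> carrier ?R" unfolding u'_def
  proof (rule adeleI[where B = B])
    fix v assume v: "v \<in> nonarchimedean_places" "v \<notin> B"
    note v' = nonarchimedean_placesD[OF v(1)]
    interpret V: valued_field "K v" "local_abs v" by (rule valued_field_completion[OF v'])
    show "local_abs v (inv\<^bsub>K v\<^esub> (u v)) \<le> 1"
      using V.abs_inv[OF adele_carrier[OF u v']] nz[OF v'] unit[OF v] by (simp add: uv[OF v'])
  qed (use inv B in auto)
  have "u \<otimes>\<^bsub>?R\<^esub> u' = \<one>\<^bsub>?R\<^esub>"
    unfolding adele_ring_simps by (rule restrict_ext) (simp add: u'_def inv)
  then have "u \<in> Units ?R"
    using u u' R.m_comm by (auto simp: Units_def)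
  then show "\<exists>t\<in>carrier ?R. a \<oplus>\<^bsub>?R\<^esub> t \<otimes>\<^bsub>?R\<^esub> b \<in> Units ?R"
    using s by (auto simp: u_def)
qed

end

theorem theorem3p2p1:
  fixes F :: "('a, 'm) ring_scheme" and n :: nat
  assumes "global_field F" and "n \<ge> 1"
  shows "star_euclidean (matrix_ring n (adele_ring F)) transpose_mat"
proof -
  have "field F"
    using assms(1)
    by (auto simp: global_field_def number_field_def function_field_over_finite_field_def)
  then interpret adelic_field F
    by (simp add: adelic_field_def)
  show ?thesis
    by (rule cring.star_euclidean_matrix_ring[OF adele_ring_cring adele_ring_stable_range_one])
qed

end
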